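(* Let $Z$ be a central ideal of a triassociative algebra $L$ over a field $\mathbb{F}$. The sequence $$\mathcal{H}^2(L/Z,\mathbb{F})\xrightarrow{\mathrm{Inf}}\mathcal{H}^2(L,\mathbb{F})\xrightarrow{\delta}\big(\mathrm{Bil}(L/L'\times Z,\mathbb{F})\oplus\mathrm{Bil}(Z\times L/L',\mathbb{F})\big)^3$$ is exact (at $\mathcal{H}^2(L,\mathbb{F})$).
   Context: Fix a field $\mathbb{F}$. A triassociative algebra is an $\mathbb{F}$-vector space $L$ with three bilinear products $\vdash,\dashv,\perp:L\times L\to L$ satisfying, for all $x,y,z\in L$: $(x\vdash y)\vdash z=x\vdash(y\vdash z)$; $(x\dashv y)\dashv z=x\dashv(y\dashv z)$; $(x\dashv y)\vdash z=x\vdash(y\vdash z)$; $(x\dashv y)\dashv z=x\dashv(y\vdash z)$; $(x\vdash y)\dashv z=x\vdash(y\dashv z)$; $(x\perp y)\vdash z=x\vdash(y\vdash z)$; $(x\dashv y)\dashv z=x\dashv(y\perp z)$; $(x\vdash y)\perp z=x\vdash(y\perp z)$; $(x\perp y)\dashv z=x\perp(y\dashv z)$; $(x\dashv y)\perp z=x\perp(y\vdash z)$; $(x\perp y)\perp z=x\perp(y\perp z)$. Ideals and quotients are defined in the usual way. The center $Z(L)$ is the set of all $z\in L$ with $z*x=x*z=0$ for all $x\in L$ and $*\in\{\vdash,\dashv,\perp\}$; a central ideal is an ideal contained in $Z(L)$. $L'=L\vdash L+L\dashv L+L\perp L$, where $L*L$ is the span of all $x*y$. Cohomology: $\mathbb{F}$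 is regarded as having zero products and trivial action. For a triassociative algebra $B$, $\mathcal{Z}^2(B,\mathbb{F})$ is the space of triples $(f_\vdash,f_\dashv,f_\perp)$ of bilinear forms $B\times B\to\mathbb{F}$ such that for all $x,y,z\in B$: $f_\vdash(x\vdash y,z)=f_\vdash(x,y\vdash z)$; $f_\dashv(x\dashv y,z)=f_\dashv(x,y\dashv z)$; $f_\vdash(x\dashv y,z)=f_\vdash(x,y\vdash z)$; $f_\dashv(x\dashv y,z)=f_\dashv(x,y\vdash z)$; $f_\dashv(x\vdash y,z)=f_\vdash(x,y\dashv z)$; $f_\vdash(x\perp y,z)=f_\vdash(x,y\vdash z)$; $f_\dashv(x\dashv y,z)=f_\dashv(x,y\perp z)$; $f_\perp(x\vdash y,z)=f_\vdash(x,y\perp z)$; $f_\dashv(x\perp y,z)=f_\perp(x,y\dashv z)$; $f_\perp(x\dashv y,z)=f_\perp(x,y\vdash z)$; $f_\perp(x\perp y,z)=f_\perp(x,y\perp z)$. $\mathcal{B}^2(B,\mathbb{F})$ is the subspace of triples with $f_*(x,y)=-\varepsilon(x*y)$ for all $x,y\in B$ and all $*\in\{\vdash,\dashv,\perp\}$, for some linear $\varepsilon:B\to\mathbb{F}$. $\mathcal{H}^2(B,\mathbb{F})=\mathcal{Z}^2(B,\mathbb{F})/\mathcal{B}^2(B,\mathbb{F})$. Maps: $\mathrm{Inf}$ sends the class of $(f_\vdash,f_\dashv,f_\perp)\in\mathcal{Z}^2(L/Z,\mathbb{F})$ to the class of $(f'_\vdash,f'_\dashv,f'_\perp)$ with $f'_*(x,y)=f_*(x+Z,y+Z)$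 for $x,y\in L$. The map $\delta$ sends the class of $(f'_\vdash,f'_\dashv,f'_\perp)\in\mathcal{Z}^2(L,\mathbb{F})$ to $(f''_\vdash,g''_\vdash,f''_\dashv,g''_\dashv,f''_\perp,g''_\perp)$, where $f''_*(x+L',z)=f'_*(x,z)$ and $g''_*(z,x+L')=f'_*(z,x)$ for $x\in L$, $z\in Z$, $*\in\{\vdash,\dashv,\perp\}$ (these are well defined). $\mathrm{Bil}(U\times V,\mathbb{F})$ denotes the space of bilinear forms $U\times V\to\mathbb{F}$. *)

theory Defs
  imports "HOL-Algebra.Module" "HOL-Algebra.QuotRing" "HOL-Algebra.Chinese_Remainder"
begin

section \<open>Linear algebra over a field in the style of HOL-Algebra\<close>

text \<open>
  Vector spaces are records of type \<open>module\<close>. These extend the ring record, whose fields \<open>mult\<close> and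
  \<open>one\<close> play no role for a module; the constructions below fill them with arbitrary values.
  Functions on a carrier are taken extensional, so that equality in a space of functions is equality
  on the carrier.
\<close>

definition lin_maps ::
  "('k, 'f) ring_scheme \<Rightarrow> ('k, 'a, 'm) module_scheme \<Rightarrow> ('k, 'b, 'n) module_scheme \<Rightarrow> ('a \<Rightarrow> 'b) set"
  where "lin_maps F M N =
    {h \<in> hom (add_monoid M) (add_monoid N).
       \<forall>a\<in>carrier F. \<forall>x\<in>carrier M. h (a \<odot>\<^bsub>M\<^esub> x) = a \<odot>\<^bsub>N\<^esub> h x}"

definition field_module :: "('k, 'f) ring_scheme \<Rightarrow> ('k, 'k) module"
  where "field_module F =
    ring.extend (ring.truncate F) (module.fields (\<lambda>a x. a \<otimes>\<^bsub>F\<^esub> x))"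

definition mod_quot :: "('k, 'a, 'm) module_scheme \<Rightarrow> 'a set \<Rightarrow> ('k, 'a set) module"
  where "mod_quot M N =
    ring.extend (M Quot N) (module.fields (\<lambda>a A. \<Union>x\<in>A. N +>\<^bsub>M\<^esub> (a \<odot>\<^bsub>M\<^esub> x)))"

definition mod_span :: "('k, 'f) ring_scheme \<Rightarrow> ('k, 'a, 'm) module_scheme \<Rightarrow> 'a set \<Rightarrow> 'a set"
  where "mod_span F M S = \<Inter> {N. submodule N F M \<and> S \<subseteq> N}"

definition mod_sum ::
  "('k, 'a, 'm) module_scheme \<Rightarrow> ('k, 'b, 'n) module_scheme \<Rightarrow> ('k, 'a \<times> 'b) module"
  where "mod_sum M N =
    ring.extend (RDirProd M N) (module.fields (\<lambda>a (x, y). (a \<odot>\<^bsub>M\<^esub> x, a \<odot>\<^bsub>N\<^esub> y)))"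

text \<open>
  \<open>Bil F U V\<close> is the space of bilinear forms on \<open>U \<times> V\<close>. To form it for a subspace \<open>Z\<close> of \<open>V\<close>, one
  passes \<open>V\<lparr>carrier := Z\<rparr>\<close>.
\<close>

definition Bil ::
  "('k, 'f) ring_scheme \<Rightarrow> ('k, 'a, 'm) module_scheme \<Rightarrow> ('k, 'b, 'n) module_scheme
    \<Rightarrow> ('k, 'a \<times> 'b \<Rightarrow> 'k) module"
  where "Bil F U V =
    \<lparr>carrier = {f \<in> extensional (carrier U \<times> carrier V).
        (\<forall>u\<in>carrier U. (\<lambda>v. f (u, v)) \<in> lin_maps F V (field_module F)) \<and>
        (\<forall>v\<in>carrier V. (\<lambda>u. f (u, v)) \<in> lin_maps F U (field_module F))},
     monoid.mult = undefined,
     monoid.one = undefined,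
     zero = (\<lambda>p\<in>carrier U \<times> carrier V. \<zero>\<^bsub>F\<^esub>),
     add = (\<lambda>f g. \<lambda>p\<in>carrier U \<times> carrier V. f p \<oplus>\<^bsub>F\<^esub> g p),
     smult = (\<lambda>a f. \<lambda>p\<in>carrier U \<times> carrier V. a \<otimes>\<^bsub>F\<^esub> f p)\<rparr>"

definition exact_at ::
  "('k, 'f) ring_scheme \<Rightarrow> ('k, 'a, 'l) module_scheme \<Rightarrow> ('a \<Rightarrow> 'b) \<Rightarrow> ('k, 'b, 'm) module_scheme
    \<Rightarrow> ('b \<Rightarrow> 'c) \<Rightarrow> ('k, 'c, 'n) module_scheme \<Rightarrow> bool"
  where "exact_at F A f B g C \<longleftrightarrow>
    f \<in> lin_maps F A B \<and> g \<in> lin_maps F B C \<and> f ` carrier A = a_kernel B C g"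


section \<open>Triassociative algebras\<close>

text \<open>
  The three products are a family indexed by \<open>tri_op\<close>. Likewise a triple with one component for each
  product is a function on \<open>tri_op\<close>.
\<close>

datatype tri_op = Vdash | Dashv | Perp

record ('k, 'a) tri_alg = "('k, 'a) module" +
  prd :: "tri_op \<Rightarrow> 'a \<Rightarrow> 'a \<Rightarrow> 'a"

text \<open>The symbol is otherwise the least element of an order in HOL-Algebra.\<close>

no_notation bottom (\<open>\<bottom>\<index>\<close>)

abbreviation vdash :: "('k, 'a, 'm) tri_alg_scheme \<Rightarrow> 'a \<Rightarrow> 'a \<Rightarrow> 'a" (infixl \<open>\<turnstile>\<index>\<close> 70)
  where "x \<turnstile>\<^bsub>L\<^esub> y \<equiv> prd L Vdash x y"

abbreviation dashv :: "('k, 'a, 'm) tri_alg_scheme \<Rightarrow> 'a \<Rightarrow> 'a \<Rightarrow> 'a" (infixl \<open>\<stileturn>\<index>\<close> 70)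
  where "x \<stileturn>\<^bsub>L\<^esub> y \<equiv> prd L Dashv x y"

abbreviation perp :: "('k, 'a, 'm) tri_alg_scheme \<Rightarrow> 'a \<Rightarrow> 'a \<Rightarrow> 'a" (infixl \<open>\<bottom>\<index>\<close> 70)
  where "x \<bottom>\<^bsub>L\<^esub> y \<equiv> prd L Perp x y"

locale tri_identities =
  fixes L :: "('k, 'a, 'm) tri_alg_scheme" (structure)
  assumes tri_identities:
    "\<lbrakk>x \<in> carrier L; y \<in> carrier L; z \<in> carrier L\<rbrakk> \<Longrightarrow> (x \<turnstile> y) \<turnstile> z = x \<turnstile> (y \<turnstile> z)"
    "\<lbrakk>x \<in> carrier L; y \<in> carrier L; z \<in> carrier L\<rbrakk> \<Longrightarrow> (x \<stileturn> y) \<stileturn> z = x \<stileturn> (y \<stileturn> z)"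
    "\<lbrakk>x \<in> carrier L; y \<in> carrier L; z \<in> carrier L\<rbrakk> \<Longrightarrow> (x \<stileturn> y) \<turnstile> z = x \<turnstile> (y \<turnstile> z)"
    "\<lbrakk>x \<in> carrier L; y \<in> carrier L; z \<in> carrier L\<rbrakk> \<Longrightarrow> (x \<stileturn> y) \<stileturn> z = x \<stileturn> (y \<turnstile> z)"
    "\<lbrakk>x \<in> carrier L; y \<in> carrier L; z \<in> carrier L\<rbrakk> \<Longrightarrow> (x \<turnstile> y) \<stileturn> z = x \<turnstile> (y \<stileturn> z)"
    "\<lbrakk>x \<in> carrier L; y \<in> carrier L; z \<in> carrier L\<rbrakk> \<Longrightarrow> (x \<bottom> y) \<turnstile> z = x \<turnstile> (y \<turnstile> z)"
    "\<lbrakk>x \<in> carrier L; y \<in> carrier L; z \<in> carrier L\<rbrakk> \<Longrightarrow> (x \<stileturn> y) \<stileturn> z = x \<stileturn> (y \<bottom> z)"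
    "\<lbrakk>x \<in> carrier L; y \<in> carrier L; z \<in> carrier L\<rbrakk> \<Longrightarrow> (x \<turnstile> y) \<bottom> z = x \<turnstile> (y \<bottom> z)"
    "\<lbrakk>x \<in> carrier L; y \<in> carrier L; z \<in> carrier L\<rbrakk> \<Longrightarrow> (x \<bottom> y) \<stileturn> z = x \<bottom> (y \<stileturn> z)"
    "\<lbrakk>x \<in> carrier L; y \<in> carrier L; z \<in> carrier L\<rbrakk> \<Longrightarrow> (x \<stileturn> y) \<bottom> z = x \<bottom> (y \<turnstile> z)"
    "\<lbrakk>x \<in> carrier L; y \<in> carrier L; z \<in> carrier L\<rbrakk> \<Longrightarrow> (x \<bottom> y) \<bottom> z = x \<bottom> (y \<bottom> z)"

locale triassociative_algebra = field F + module F L + tri_identities L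
  for F :: "('k, 'f) ring_scheme" (structure) and L :: "('k, 'a, 'm) tri_alg_scheme" (structure) +
  assumes prd_linear_right: "x \<in> carrier L \<Longrightarrow> (\<lambda>y. prd L op x y) \<in> lin_maps F L L"
    and prd_linear_left: "y \<in> carrier L \<Longrightarrow> (\<lambda>x. prd L op x y) \<in> lin_maps F L L"

definition tri_ideal :: "('k, 'f) ring_scheme \<Rightarrow> ('k, 'a, 'm) tri_alg_scheme \<Rightarrow> 'a set \<Rightarrow> bool"
  where "tri_ideal F L I \<longleftrightarrow> submodule I F L \<and>
    (\<forall>op. \<forall>i\<in>I. \<forall>x\<in>carrier L. prd L op i x \<in> I \<and> prd L op x i \<in> I)"

definition tri_center :: "('k, 'a, 'm) tri_alg_scheme \<Rightarrow> 'a set"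
  where "tri_center L = {z \<in> carrier L.
    \<forall>op. \<forall>x\<in>carrier L. prd L op z x = \<zero>\<^bsub>L\<^esub> \<and> prd L op x z = \<zero>\<^bsub>L\<^esub>}"

definition central_ideal :: "('k, 'f) ring_scheme \<Rightarrow> ('k, 'a, 'm) tri_alg_scheme \<Rightarrow> 'a set \<Rightarrow> bool"
  where "central_ideal F L Z \<longleftrightarrow> tri_ideal F L Z \<and> Z \<subseteq> tri_center L"

definition tri_quot :: "('k, 'a, 'm) tri_alg_scheme \<Rightarrow> 'a set \<Rightarrow> ('k, 'a set) tri_alg"
  where "tri_quot L I = module.extend (mod_quot L I)
    (tri_alg.fields (\<lambda>op A C. \<Union>x\<in>A. \<Union>y\<in>C. I +>\<^bsub>L\<^esub> prd L op x y))"

definition prd_span :: "('k, 'f) ring_scheme \<Rightarrow> ('k, 'a, 'm) tri_alg_scheme \<Rightarrow> tri_op \<Rightarrow> 'a set"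
  where "prd_span F L op = mod_span F L {prd L op x y | x y. x \<in> carrier L \<and> y \<in> carrier L}"

definition derived :: "('k, 'f) ring_scheme \<Rightarrow> ('k, 'a, 'm) tri_alg_scheme \<Rightarrow> 'a set"
  where "derived F L = prd_span F L Vdash <+>\<^bsub>L\<^esub> prd_span F L Dashv <+>\<^bsub>L\<^esub> prd_span F L Perp"

text \<open>The third power of a module, with one component for each of the three products.\<close>

definition mod_cube :: "('k, 'a, 'm) module_scheme \<Rightarrow> ('k, tri_op \<Rightarrow> 'a) module"
  where "mod_cube M =
    \<lparr>carrier = {f. \<forall>op. f op \<in> carrier M},
     monoid.mult = undefined,
     monoid.one = undefined,
     zero = (\<lambda>op. \<zero>\<^bsub>M\<^esub>),
     add = (\<lambda>f g op. f op \<oplus>\<^bsub>M\<^esub> g op),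
     smult = (\<lambda>a f op. a \<odot>\<^bsub>M\<^esub> f op)\<rparr>"


section \<open>Second cohomology with trivial coefficients\<close>

locale cocycle_identities =
  fixes B :: "('k, 'a, 'm) tri_alg_scheme" (structure) and f :: "tri_op \<Rightarrow> 'a \<times> 'a \<Rightarrow> 'k"
  assumes cocycle_identities:
    "\<lbrakk>x \<in> carrier B; y \<in> carrier B; z \<in> carrier B\<rbrakk> \<Longrightarrow> f Vdash (x \<turnstile> y, z) = f Vdash (x, y \<turnstile> z)"
    "\<lbrakk>x \<in> carrier B; y \<in> carrier B; z \<in> carrier B\<rbrakk> \<Longrightarrow> f Dashv (x \<stileturn> y, z) = f Dashv (x, y \<stileturn> z)"
    "\<lbrakk>x \<in> carrier B; y \<in> carrier B; z \<in> carrier B\<rbrakk> \<Longrightarrow> f Vdash (x \<stileturn> y, z) = f Vdash (x, y \<turnstile> z)"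
    "\<lbrakk>x \<in> carrier B; y \<in> carrier B; z \<in> carrier B\<rbrakk> \<Longrightarrow> f Dashv (x \<stileturn> y, z) = f Dashv (x, y \<turnstile> z)"
    "\<lbrakk>x \<in> carrier B; y \<in> carrier B; z \<in> carrier B\<rbrakk> \<Longrightarrow> f Dashv (x \<turnstile> y, z) = f Vdash (x, y \<stileturn> z)"
    "\<lbrakk>x \<in> carrier B; y \<in> carrier B; z \<in> carrier B\<rbrakk> \<Longrightarrow> f Vdash (x \<bottom> y, z) = f Vdash (x, y \<turnstile> z)"
    "\<lbrakk>x \<in> carrier B; y \<in> carrier B; z \<in> carrier B\<rbrakk> \<Longrightarrow> f Dashv (x \<stileturn> y, z) = f Dashv (x, y \<bottom> z)"
    "\<lbrakk>x \<in> carrier B; y \<in> carrier B; z \<in> carrier B\<rbrakk> \<Longrightarrow> f Perp (x \<turnstile> y, z) = f Vdash (x, y \<bottom> z)"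
    "\<lbrakk>x \<in> carrier B; y \<in> carrier B; z \<in> carrier B\<rbrakk> \<Longrightarrow> f Dashv (x \<bottom> y, z) = f Perp (x, y \<stileturn> z)"
    "\<lbrakk>x \<in> carrier B; y \<in> carrier B; z \<in> carrier B\<rbrakk> \<Longrightarrow> f Perp (x \<stileturn> y, z) = f Perp (x, y \<turnstile> z)"
    "\<lbrakk>x \<in> carrier B; y \<in> carrier B; z \<in> carrier B\<rbrakk> \<Longrightarrow> f Perp (x \<bottom> y, z) = f Perp (x, y \<bottom> z)"

definition Z2 ::
  "('k, 'f) ring_scheme \<Rightarrow> ('k, 'a, 'm) tri_alg_scheme \<Rightarrow> ('k, tri_op \<Rightarrow> 'a \<times> 'a \<Rightarrow> 'k) module"
  where "Z2 F B = (mod_cube (Bil F B B))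
    \<lparr>carrier := {f \<in> carrier (mod_cube (Bil F B B)). cocycle_identities B f}\<rparr>"

definition B2 ::
  "('k, 'f) ring_scheme \<Rightarrow> ('k, 'a, 'm) tri_alg_scheme \<Rightarrow> (tri_op \<Rightarrow> 'a \<times> 'a \<Rightarrow> 'k) set"
  where "B2 F B =
    {\<lambda>op. \<lambda>(x, y)\<in>carrier B \<times> carrier B. \<ominus>\<^bsub>F\<^esub> \<epsilon> (prd B op x y) | \<epsilon>.
       \<epsilon> \<in> lin_maps F B (field_module F)}"

definition H2 ::
  "('k, 'f) ring_scheme \<Rightarrow> ('k, 'a, 'm) tri_alg_scheme \<Rightarrow> ('k, (tri_op \<Rightarrow> 'a \<times> 'a \<Rightarrow> 'k) set) module"
  where "H2 F B = mod_quot (Z2 F B) (B2 F B)"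


section \<open>Inflation and the map \<open>\<delta>\<close>\<close>

text \<open>
  A map defined on classes through representatives is expressed with \<open>the_elem\<close>: it yields the
  common value on all representatives, and is unspecified when the value depends on the choice.
  That the maps are well defined is thus not built into the definitions; it is needed for them to be
  linear maps between the stated spaces.
\<close>

definition inf_cochain ::
  "('k, 'a, 'm) tri_alg_scheme \<Rightarrow> 'a set \<Rightarrow> (tri_op \<Rightarrow> 'a set \<times> 'a set \<Rightarrow> 'k) \<Rightarrow> tri_op \<Rightarrow> 'a \<times> 'a \<Rightarrow> 'k"
  where "inf_cochain L Z f =
    (\<lambda>op. \<lambda>(x, y)\<in>carrier L \<times> carrier L. f op (Z +>\<^bsub>L\<^esub> x, Z +>\<^bsub>L\<^esub> y))"

definition Inf_map ::
  "('k, 'f) ring_scheme \<Rightarrow> ('k, 'a, 'm) tri_alg_scheme \<Rightarrow> 'a set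
    \<Rightarrow> (tri_op \<Rightarrow> 'a set \<times> 'a set \<Rightarrow> 'k) set \<Rightarrow> (tri_op \<Rightarrow> 'a \<times> 'a \<Rightarrow> 'k) set"
  where "Inf_map F L Z c = the_elem ((\<lambda>f. B2 F L +>\<^bsub>Z2 F L\<^esub> inf_cochain L Z f) ` c)"

definition delta_cochain ::
  "('k, 'f) ring_scheme \<Rightarrow> ('k, 'a, 'm) tri_alg_scheme \<Rightarrow> 'a set \<Rightarrow> (tri_op \<Rightarrow> 'a \<times> 'a \<Rightarrow> 'k)
    \<Rightarrow> tri_op \<Rightarrow> ('a set \<times> 'a \<Rightarrow> 'k) \<times> ('a \<times> 'a set \<Rightarrow> 'k)"
  where "delta_cochain F L Z f = (\<lambda>op.
    (\<lambda>(A, z)\<in>carrier (tri_quot L (derived F L)) \<times> Z. the_elem ((\<lambda>x. f op (x, z)) ` A),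
     \<lambda>(z, A)\<in>Z \<times> carrier (tri_quot L (derived F L)). the_elem ((\<lambda>x. f op (z, x)) ` A)))"

definition delta_map ::
  "('k, 'f) ring_scheme \<Rightarrow> ('k, 'a, 'm) tri_alg_scheme \<Rightarrow> 'a set \<Rightarrow> (tri_op \<Rightarrow> 'a \<times> 'a \<Rightarrow> 'k) set
    \<Rightarrow> tri_op \<Rightarrow> ('a set \<times> 'a \<Rightarrow> 'k) \<times> ('a \<times> 'a set \<Rightarrow> 'k)"
  where "delta_map F L Z c = the_elem (delta_cochain F L Z ` c)"

definition delta_target ::
  "('k, 'f) ring_scheme \<Rightarrow> ('k, 'a, 'm) tri_alg_scheme \<Rightarrow> 'a set
    \<Rightarrow> ('k, tri_op \<Rightarrow> ('a set \<times> 'a \<Rightarrow> 'k) \<times> ('a \<times> 'a set \<Rightarrow> 'k)) module"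
  where "delta_target F L Z = mod_cube
    (mod_sum (Bil F (tri_quot L (derived F L)) (L\<lparr>carrier := Z\<rparr>))
             (Bil F (L\<lparr>carrier := Z\<rparr>) (tri_quot L (derived F L))))"

end

theory Submission
  imports Defs
begin

text \<open>
  For a cocycle \<open>f\<close> on \<open>L\<close> and central \<open>z\<close>, the cocycle identities move any product in one argument
  into a product with \<open>z\<close>, so \<open>f\<close> vanishes on \<open>L' \<times> Z\<close> and \<open>Z \<times> L'\<close>; a coboundary even vanishes on
  \<open>L \<times> Z\<close> and \<open>Z \<times> L\<close>. Hence \<open>\<delta>\<close> is well defined on classes, and \<open>\<delta>\<close> kills the class of \<open>f\<close> iff \<open>f\<close> itself
  vanishes on \<open>L \<times> Z\<close> and \<open>Z \<times> L\<close>. By bilinearity this says exactly that \<open>f\<close> is the inflation of a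
  cocycle on \<open>L/Z\<close>, with no correction by a coboundary needed.
\<close>

section \<open>Linear maps, quotients and powers of modules\<close>

text \<open>The maps of the sequence are given by \<open>the_elem\<close> of an image of a coset, so
  neither their values nor their linearity come for free. Two facts supply them everywhere.
  \<open>the_elem_coset\<close> evaluates such a term at a representative once the function is
  unchanged by adding elements of the submodule, and \<open>linear_on_quotient\<close> makes the
  resulting map linear. They serve for classes modulo \<open>B2\<close>, for cosets of L' in the
  pairings, and for cosets of Z when a cocycle is pushed down to L/Z. The theory of
  \<open>Z2\<close> and \<open>B2\<close> is developed for an arbitrary triassociative algebra,
  because it is applied to both L and L/Z; this is why L/Z is shown to satisfy all eleven identities
  again. As forms are extensional, every equation between cochains is checked on pairs of elements
  of the carriers.\<close>

lemma lin_mapsI: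
  assumes "\<And>x. x \<in> carrier M \<Longrightarrow> h x \<in> carrier N"
    and "\<And>x y. \<lbrakk>x \<in> carrier M; y \<in> carrier M\<rbrakk> \<Longrightarrow> h (x \<oplus>\<^bsub>M\<^esub> y) = h x \<oplus>\<^bsub>N\<^esub> h y"
    and "\<And>a x. \<lbrakk>a \<in> carrier F; x \<in> carrier M\<rbrakk> \<Longrightarrow> h (a \<odot>\<^bsub>M\<^esub> x) = a \<odot>\<^bsub>N\<^esub> h x"
  shows "h \<in> lin_maps F M N"
  using assms by (simp add: lin_maps_def hom_def Pi_iff)

lemma lin_mapsD:
  assumes "h \<in> lin_maps F M N"
  shows lin_maps_closed: "x \<in> carrier M \<Longrightarrow> h x \<in> carrier N"
    and lin_maps_add: "\<lbrakk>x \<in> carrier M; y \<in> carrier M\<rbrakk> \<Longrightarrow> h (x \<oplus>\<^bsub>M\<^esub> y) = h x \<oplus>\<^bsub>N\<^esub> h y"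
    and lin_maps_smult: "\<lbrakk>a \<in> carrier F; x \<in> carrier M\<rbrakk> \<Longrightarrow> h (a \<odot>\<^bsub>M\<^esub> x) = a \<odot>\<^bsub>N\<^esub> h x"
  using assms by (auto simp: lin_maps_def hom_def)

lemma lin_maps_zero:
  assumes "h \<in> lin_maps F M N" "module F M" "module F N"
  shows "h \<zero>\<^bsub>M\<^esub> = \<zero>\<^bsub>N\<^esub>"
proof -
  interpret M: module F M by fact
  interpret N: module F N by fact
  have "h (\<zero>\<^bsub>F\<^esub> \<odot>\<^bsub>M\<^esub> \<zero>\<^bsub>M\<^esub>) = \<zero>\<^bsub>F\<^esub> \<odot>\<^bsub>N\<^esub> h \<zero>\<^bsub>M\<^esub>"
    using assms(1) by (intro lin_maps_smult) auto
  then show ?thesis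
    using lin_maps_closed[OF assms(1)] by simp
qed

lemma field_module_sel [simp]:
  "carrier (field_module F) = carrier F"
  "add (field_module F) = add F"
  "zero (field_module F) = zero F"
  "smult (field_module F) = mult F"
  by (simp_all add: field_module_def ring.defs module.defs)

lemma module_field_module:
  assumes "cring F"
  shows "module F (field_module F)"
proof -
  interpret cring F by fact
  have "\<exists>b\<in>carrier F. b \<oplus>\<^bsub>F\<^esub> a = \<zero>\<^bsub>F\<^esub>" if "a \<in> carrier F" for a
    using that l_neg by blast
  then show ?thesis
    by (intro moduleI abelian_groupI)
       (simp_all add: a_ac m_assoc l_distr r_distr cring_axioms)
qed

lemma mod_quot_sel:
  "carrier (mod_quot M N) = a_rcosets\<^bsub>M\<^esub> N"
  "add (mod_quot M N) = set_add M"
  "zero (mod_quot M N) = N"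
  "smult (mod_quot M N) = (\<lambda>a A. \<Union>x\<in>A. N +>\<^bsub>M\<^esub> (a \<odot>\<^bsub>M\<^esub> x))"
  by (simp_all add: mod_quot_def FactRing_def ring.defs module.defs)

lemma mod_sum_sel [simp]:
  "carrier (mod_sum M N) = carrier M \<times> carrier N"
  "add (mod_sum M N) p q = (fst p \<oplus>\<^bsub>M\<^esub> fst q, snd p \<oplus>\<^bsub>N\<^esub> snd q)"
  "zero (mod_sum M N) = (\<zero>\<^bsub>M\<^esub>, \<zero>\<^bsub>N\<^esub>)"
  "smult (mod_sum M N) a p = (a \<odot>\<^bsub>M\<^esub> fst p, a \<odot>\<^bsub>N\<^esub> snd p)"
  by (simp_all add: mod_sum_def RDirProd_def DirProd_def monoid.defs ring.defs module.defs
        split_beta)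

lemma mod_cube_sel [simp]:
  "f \<in> carrier (mod_cube M) \<longleftrightarrow> (\<forall>op. f op \<in> carrier M)"
  "add (mod_cube M) f g = (\<lambda>op. f op \<oplus>\<^bsub>M\<^esub> g op)"
  "zero (mod_cube M) = (\<lambda>op. \<zero>\<^bsub>M\<^esub>)"
  "smult (mod_cube M) a f = (\<lambda>op. a \<odot>\<^bsub>M\<^esub> f op)"
  by (simp_all add: mod_cube_def)

lemma module_mod_cube:
  assumes "module F M"
  shows "module F (mod_cube M)"
proof -
  interpret module F M by fact
  have "\<exists>g\<in>carrier (mod_cube M). g \<oplus>\<^bsub>mod_cube M\<^esub> f = \<zero>\<^bsub>mod_cube M\<^esub>"
    if "f \<in> carrier (mod_cube M)" for f
    using that by (intro bexI[of _ "\<lambda>op. \<ominus>\<^bsub>M\<^esub> f op"]) (auto simp: M.l_neg)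
  then show ?thesis
    by (intro moduleI abelian_groupI)
       (simp_all add: M.a_ac smult_l_distr smult_r_distr smult_assoc1 R.cring_axioms)
qed

text \<open>The module laws see only these four fields. This carries them from
  \<open>mod_quot\<close> to \<open>tri_quot\<close>, a larger record with the same module
  part.\<close>

lemma module_cong:
  assumes "module F M" "carrier M' = carrier M" "add M' = add M" "zero M' = zero M" "smult M' = smult M"
  shows "module F M'"
proof -
  interpret module F M by fact
  have "\<exists>y\<in>carrier M. y \<oplus>\<^bsub>M\<^esub> x = \<zero>\<^bsub>M\<^esub>" if "x \<in> carrier M" for x
    using that M.l_neg by blast
  then show ?thesis
    by (intro moduleI abelian_groupI)
       (simp_all add: assms(2-) M.a_ac smult_l_distr smult_r_distr smult_assoc1 R.cring_axioms)
qed

text \<open>Closure under negation is closure under the scalar -1.\<close>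

lemma (in module) submoduleI_smult:
  assumes "H \<subseteq> carrier M" "\<zero>\<^bsub>M\<^esub> \<in> H"
    and "\<And>x y. \<lbrakk>x \<in> H; y \<in> H\<rbrakk> \<Longrightarrow> x \<oplus>\<^bsub>M\<^esub> y \<in> H"
    and smult: "\<And>a x. \<lbrakk>a \<in> carrier R; x \<in> H\<rbrakk> \<Longrightarrow> a \<odot>\<^bsub>M\<^esub> x \<in> H"
  shows "submodule H R M"
proof (rule submoduleI)
  show "\<ominus>\<^bsub>M\<^esub> x \<in> H" if "x \<in> H" for x
    using smult[of "\<ominus> \<one>" x] smult_l_minus[of \<one> x] that assms(1) by auto
qed (use assms in auto)

lemma submodule_kernel:
  assumes h: "h \<in> lin_maps F M P" and "module F M" "module F P"
  shows "submodule {x \<in> carrier M. h x = \<zero>\<^bsub>P\<^esub>} F M"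
proof -
  interpret M: module F M by fact
  interpret P: module F P by fact
  show ?thesis
    by (rule M.submoduleI_smult) (auto simp: lin_mapsD[OF h] lin_maps_zero[OF assms])
qed

lemma (in module) submodule_mod_span:
  assumes "S \<subseteq> carrier M"
  shows "submodule (mod_span R M S) R M"
proof -
  \<comment> \<open>The carrier is itself a submodule containing \<open>S\<close>, so the
    intersected family is not empty.\<close>
  have "mod_span R M S \<subseteq> carrier M"
    using assms carrier_is_submodule by (auto simp: mod_span_def)
  then show ?thesis
    by (rule submoduleI_smult)
       (auto simp: mod_span_def submodule.smult_closed submoduleE(5)
         subgroup.one_closed[OF submodule.axioms(1), simplified])
qed

lemma mod_span_least: "\<lbrakk>submodule N F M; S \<subseteq> N\<rbrakk> \<Longrightarrow> mod_span F M S \<subseteq> N"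
  by (auto simp: mod_span_def)

lemma set_addI: "\<lbrakk>h \<in> H; k \<in> K\<rbrakk> \<Longrightarrow> h \<oplus>\<^bsub>G\<^esub> k \<in> H <+>\<^bsub>G\<^esub> K"
  by (auto simp: set_add_def')

lemma (in module) submodule_set_add:
  assumes H: "submodule H R M" and K: "submodule K R M"
  shows "submodule (H <+>\<^bsub>M\<^esub> K) R M"
proof (rule submoduleI_smult)
  note sub = subsetD[OF submoduleE(1)[OF H]] subsetD[OF submoduleE(1)[OF K]]
  show "H <+>\<^bsub>M\<^esub> K \<subseteq> carrier M"
    using sub by (auto simp: set_add_def')
  have "\<zero>\<^bsub>M\<^esub> \<in> H" "\<zero>\<^bsub>M\<^esub> \<in> K"
    using H K subgroup.one_closed submodule.axioms(1) by fastforce+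
  then show "\<zero>\<^bsub>M\<^esub> \<in> H <+>\<^bsub>M\<^esub> K"
    using set_addI[of "\<zero>\<^bsub>M\<^esub>" H "\<zero>\<^bsub>M\<^esub>" K M] by simp
  fix x y assume "x \<in> H <+>\<^bsub>M\<^esub> K" "y \<in> H <+>\<^bsub>M\<^esub> K"
  then obtain h k h' k' where hk: "h \<in> H" "k \<in> K" "h' \<in> H" "k' \<in> K"
    and xy: "x = h \<oplus>\<^bsub>M\<^esub> k" "y = h' \<oplus>\<^bsub>M\<^esub> k'"
    by (auto simp: set_add_def')
  have "x \<oplus>\<^bsub>M\<^esub> y = (h \<oplus>\<^bsub>M\<^esub> h') \<oplus>\<^bsub>M\<^esub> (k \<oplus>\<^bsub>M\<^esub> k')"
    using hk by (simp add: xy sub M.a_ac)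
  then show "x \<oplus>\<^bsub>M\<^esub> y \<in> H <+>\<^bsub>M\<^esub> K"
    using hk by (simp add: set_addI submoduleE(5)[OF H] submoduleE(5)[OF K])
next
  fix a x assume a: "a \<in> carrier R" and "x \<in> H <+>\<^bsub>M\<^esub> K"
  then obtain h k where hk: "h \<in> H" "k \<in> K" and x: "x = h \<oplus>\<^bsub>M\<^esub> k"
    by (auto simp: set_add_def')
  then show "a \<odot>\<^bsub>M\<^esub> x \<in> H <+>\<^bsub>M\<^esub> K"
    using a subsetD[OF submoduleE(1)[OF H]] subsetD[OF submoduleE(1)[OF K]]
    by (simp add: smult_r_distr set_addI submoduleE(4)[OF H] submoduleE(4)[OF K])
qed

lemma (in module) set_add_subset:
  assumes "submodule K R M" "A \<subseteq> K" "B \<subseteq> K"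
  shows "A <+>\<^bsub>M\<^esub> B \<subseteq> K"
  using assms(2,3) submoduleE(5)[OF assms(1)] by (auto simp: set_add_def' subset_iff)

text \<open>The module hypothesis keeps sums and scalar multiples inside the carrier, where the two
  functions agree. This allows a restricted function or a \<open>the_elem\<close> term to be
  replaced by a plain formula.\<close>

lemma lin_maps_cong:
  assumes "module F M" "\<And>x. x \<in> carrier M \<Longrightarrow> h x = k x"
  shows "h \<in> lin_maps F M N \<longleftrightarrow> k \<in> lin_maps F M N"
proof -
  interpret module F M by fact
  show ?thesis
    using assms(2) by (simp add: lin_maps_def hom_def Pi_iff)
qed

text \<open>Applied to the one-variable slices of a form, these give the closure properties of
  \<open>Bil\<close>; applied to \<open>\<epsilon>\<close>, those of \<open>B2\<close>. The scalar
  case relies on commutativity of the base ring.\<close>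

lemma lin_maps_pointwise:
  assumes "module F P"
  shows lin_maps_pointwise_zero: "(\<lambda>x. \<zero>\<^bsub>P\<^esub>) \<in> lin_maps F M P"
    and lin_maps_pointwise_add: "\<lbrakk>h \<in> lin_maps F M P; k \<in> lin_maps F M P\<rbrakk>
      \<Longrightarrow> (\<lambda>x. h x \<oplus>\<^bsub>P\<^esub> k x) \<in> lin_maps F M P"
    and lin_maps_pointwise_smult: "\<lbrakk>a \<in> carrier F; h \<in> lin_maps F M P\<rbrakk>
      \<Longrightarrow> (\<lambda>x. a \<odot>\<^bsub>P\<^esub> h x) \<in> lin_maps F M P"
proof -
  interpret module F P by fact
  show "(\<lambda>x. \<zero>\<^bsub>P\<^esub>) \<in> lin_maps F M P"
    by (rule lin_mapsI) auto
  show "(\<lambda>x. h x \<oplus>\<^bsub>P\<^esub> k x) \<in> lin_maps F M P"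
    if hk: "h \<in> lin_maps F M P" "k \<in> lin_maps F M P"
    by (rule lin_mapsI) (simp_all add: lin_mapsD[OF hk(1)] lin_mapsD[OF hk(2)] M.a_ac smult_r_distr)
  show "(\<lambda>x. a \<odot>\<^bsub>P\<^esub> h x) \<in> lin_maps F M P"
    if a: "a \<in> carrier F" and h: "h \<in> lin_maps F M P"
    using a by (intro lin_mapsI)
      (simp_all add: lin_mapsD[OF h] smult_r_distr smult_assoc1[symmetric] R.m_comm)
qed

lemma lin_maps_subspace:
  "\<lbrakk>h \<in> lin_maps F M P; S \<subseteq> carrier M\<rbrakk> \<Longrightarrow> h \<in> lin_maps F (M\<lparr>carrier := S\<rparr>) P"
  by (auto simp: lin_maps_def hom_def Pi_iff subset_iff)

lemma lin_maps_comp: "\<lbrakk>h \<in> lin_maps F M N; k \<in> lin_maps F N P\<rbrakk> \<Longrightarrow> (\<lambda>x. k (h x)) \<in> lin_maps F M P"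
  by (simp add: lin_maps_def hom_def Pi_iff)

lemma module_mod_sum:
  assumes "module F M" "module F N"
  shows "module F (mod_sum M N)"
proof -
  interpret M: module F M by fact
  interpret N: module F N by fact
  have "\<exists>q\<in>carrier (mod_sum M N). q \<oplus>\<^bsub>mod_sum M N\<^esub> p = \<zero>\<^bsub>mod_sum M N\<^esub>"
    if "p \<in> carrier (mod_sum M N)" for p
    using that by (intro bexI[of _ "(\<ominus>\<^bsub>M\<^esub> fst p, \<ominus>\<^bsub>N\<^esub> snd p)"]) (auto simp: M.M.l_neg N.M.l_neg)
  then show ?thesis
    by (intro moduleI abelian_groupI)
       (auto simp: M.M.a_ac N.M.a_ac M.smult_l_distr M.smult_r_distr M.smult_assoc1
         N.smult_l_distr N.smult_r_distr N.smult_assoc1 M.R.cring_axioms)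
qed

section \<open>Cosets of a submodule and linear maps out of the quotient\<close>

locale module_quotient = module F M + S: submodule N F M
  for F :: "('k, 'f) ring_scheme" and M :: "('k, 'a, 'm) module_scheme" and N
begin

text \<open>Makes the coset calculus for abelian groups available; only the scalar action has to be
  treated by hand.\<close>

sublocale abelian_subgroup N M
  by (intro abelian_subgroupI3 additive_subgroupI S.subgroup_axioms M.abelian_group_axioms)

declare mod_quot_sel(1,3) [simp]

lemma cosets_cases:
  assumes "A \<in> a_rcosets\<^bsub>M\<^esub> N"
  obtains x where "x \<in> carrier M" "A = N +>\<^bsub>M\<^esub> x"
  using assms by (auto simp: A_RCOSETS_def')

lemma coset_in [simp]: "x \<in> carrier M \<Longrightarrow> N +>\<^bsub>M\<^esub> x \<in> a_rcosets\<^bsub>M\<^esub> N"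
  by (simp add: M.a_rcosetsI a_subset)

lemma coset_add_left: "\<lbrakk>n \<in> N; x \<in> carrier M\<rbrakk> \<Longrightarrow> N +>\<^bsub>M\<^esub> (n \<oplus>\<^bsub>M\<^esub> x) = N +>\<^bsub>M\<^esub> x"
  by (metis M.a_coset_add_assoc M.a_coset_join2 a_Hcarr a_subgroup a_subset)

lemma coset_of_mem: "n \<in> N \<Longrightarrow> N +>\<^bsub>M\<^esub> n = N"
  by (simp add: M.a_coset_join2 a_subgroup)

lemma in_coset_iff: "y \<in> N +>\<^bsub>M\<^esub> x \<longleftrightarrow> (\<exists>n\<in>N. y = n \<oplus>\<^bsub>M\<^esub> x)"
  by (auto simp: a_r_coset_def')

text \<open>Every element of the coset has the form \<open>n \<oplus> x\<close>, so the image is at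
  most \<open>{h x}\<close>, and it is not empty because N contains zero.\<close>

lemma the_elem_coset:
  assumes "x \<in> carrier M" and "\<And>n. n \<in> N \<Longrightarrow> h (n \<oplus>\<^bsub>M\<^esub> x) = h x"
  shows "the_elem (h ` (N +>\<^bsub>M\<^esub> x)) = h x"
proof -
  have "h ` (N +>\<^bsub>M\<^esub> x) = {h x}"
    using assms zero_closed by (auto simp: a_r_coset_def')
  then show ?thesis by simp
qed

text \<open>The scalar action on cosets is a union over representatives. All its members are the
  same coset and at least one representative exists, so the union collapses.\<close>

lemma coset_smult:
  assumes "a \<in> carrier F" "x \<in> carrier M"
  shows "a \<odot>\<^bsub>mod_quot M N\<^esub> (N +>\<^bsub>M\<^esub> x) = N +>\<^bsub>M\<^esub> (a \<odot>\<^bsub>M\<^esub> x)"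
proof -
  have "N +>\<^bsub>M\<^esub> (a \<odot>\<^bsub>M\<^esub> y) = N +>\<^bsub>M\<^esub> (a \<odot>\<^bsub>M\<^esub> x)" if "y \<in> N +>\<^bsub>M\<^esub> x" for y
    using that assms by (auto simp: in_coset_iff smult_r_distr coset_add_left)
  moreover have "x \<in> N +>\<^bsub>M\<^esub> x"
    using assms by (simp add: a_rcos_self)
  ultimately show ?thesis
    unfolding mod_quot_sel by blast
qed

lemma coset_add:
  "\<lbrakk>x \<in> carrier M; y \<in> carrier M\<rbrakk>
    \<Longrightarrow> (N +>\<^bsub>M\<^esub> x) \<oplus>\<^bsub>mod_quot M N\<^esub> (N +>\<^bsub>M\<^esub> y) = N +>\<^bsub>M\<^esub> (x \<oplus>\<^bsub>M\<^esub> y)"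
  by (simp add: a_rcos_sum mod_quot_sel)

lemma coset_linear: "(\<lambda>x. N +>\<^bsub>M\<^esub> x) \<in> lin_maps F M (mod_quot M N)"
  by (rule lin_mapsI) (simp_all add: coset_add coset_smult)

lemma zero_in_cosets: "N \<in> a_rcosets\<^bsub>M\<^esub> N"
  using coset_in[OF M.zero_closed] by (simp add: a_subset)

lemma zero_add_coset: "x \<in> carrier M \<Longrightarrow> N \<oplus>\<^bsub>mod_quot M N\<^esub> (N +>\<^bsub>M\<^esub> x) = N +>\<^bsub>M\<^esub> x"
  using coset_add[of "\<zero>\<^bsub>M\<^esub>" x] by (simp add: a_subset)

lemma module_mod_quot: "module F (mod_quot M N)"
proof (intro moduleI abelian_groupI)
  fix A assume "A \<in> carrier (mod_quot M N)"
  then obtain x where x: "x \<in> carrier M" "A = N +>\<^bsub>M\<^esub> x"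
    using cosets_cases by auto
  show "\<exists>B\<in>carrier (mod_quot M N). B \<oplus>\<^bsub>mod_quot M N\<^esub> A = \<zero>\<^bsub>mod_quot M N\<^esub>"
    using x
    by (intro bexI[of _ "N +>\<^bsub>M\<^esub> (\<ominus>\<^bsub>M\<^esub> x)"]) (simp_all add: coset_add M.l_neg a_subset)
  show "\<zero>\<^bsub>mod_quot M N\<^esub> \<oplus>\<^bsub>mod_quot M N\<^esub> A = A" "\<one>\<^bsub>F\<^esub> \<odot>\<^bsub>mod_quot M N\<^esub> A = A"
    using x by (simp_all add: zero_add_coset coset_smult)
  fix a assume a: "a \<in> carrier F"
  show "a \<odot>\<^bsub>mod_quot M N\<^esub> A \<in> carrier (mod_quot M N)"
    using x a by (simp add: coset_smult)
  {
    fix b assume b: "b \<in> carrier F"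
    show "(a \<oplus>\<^bsub>F\<^esub> b) \<odot>\<^bsub>mod_quot M N\<^esub> A = a \<odot>\<^bsub>mod_quot M N\<^esub> A \<oplus>\<^bsub>mod_quot M N\<^esub> b \<odot>\<^bsub>mod_quot M N\<^esub> A"
      "(a \<otimes>\<^bsub>F\<^esub> b) \<odot>\<^bsub>mod_quot M N\<^esub> A = a \<odot>\<^bsub>mod_quot M N\<^esub> (b \<odot>\<^bsub>mod_quot M N\<^esub> A)"
      using x a b by (simp_all add: coset_smult coset_add smult_l_distr smult_assoc1)
  }
  fix B assume "B \<in> carrier (mod_quot M N)"
  then obtain y where y: "y \<in> carrier M" "B = N +>\<^bsub>M\<^esub> y"
    using cosets_cases by auto
  show "a \<odot>\<^bsub>mod_quot M N\<^esub> (A \<oplus>\<^bsub>mod_quot M N\<^esub> B) = a \<odot>\<^bsub>mod_quot M N\<^esub> A \<oplus>\<^bsub>mod_quot M N\<^esub> a \<odot>\<^bsub>mod_quot M N\<^esub> B"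
    using x y a by (simp add: coset_smult coset_add smult_r_distr)
next
  fix A B assume "A \<in> carrier (mod_quot M N)" "B \<in> carrier (mod_quot M N)"
  then obtain x y where x: "x \<in> carrier M" "A = N +>\<^bsub>M\<^esub> x" and y: "y \<in> carrier M" "B = N +>\<^bsub>M\<^esub> y"
    using cosets_cases by (metis mod_quot_sel(1))
  show "A \<oplus>\<^bsub>mod_quot M N\<^esub> B \<in> carrier (mod_quot M N)"
    "A \<oplus>\<^bsub>mod_quot M N\<^esub> B = B \<oplus>\<^bsub>mod_quot M N\<^esub> A"
    using x y by (simp_all add: coset_add M.a_comm)
  fix C assume "C \<in> carrier (mod_quot M N)"
  then obtain z where z: "z \<in> carrier M" "C = N +>\<^bsub>M\<^esub> z"
    using cosets_cases by auto
  show "A \<oplus>\<^bsub>mod_quot M N\<^esub> B \<oplus>\<^bsub>mod_quot M N\<^esub> C = A \<oplus>\<^bsub>mod_quot M N\<^esub> (B \<oplus>\<^bsub>mod_quot M N\<^esub> C)"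
    using x y z by (simp add: coset_add M.a_assoc)
qed (simp_all add: zero_in_cosets R.cring_axioms)

text \<open>The universal property of the quotient, phrased with \<open>the_elem\<close> so that it
  matches the definitions of \<open>Inf_map\<close> and \<open>delta_map\<close> literally.\<close>

lemma linear_on_quotient:
  assumes h: "h \<in> lin_maps F M P"
    and const: "\<And>n x. \<lbrakk>n \<in> N; x \<in> carrier M\<rbrakk> \<Longrightarrow> h (n \<oplus>\<^bsub>M\<^esub> x) = h x"
  shows "(\<lambda>A. the_elem (h ` A)) \<in> lin_maps F (mod_quot M N) P"
proof (rule lin_mapsI)
  have *: "the_elem (h ` (N +>\<^bsub>M\<^esub> x)) = h x" if "x \<in> carrier M" for x
    using that by (intro the_elem_coset const)
  note lin = lin_mapsD[OF h]
  fix A assume "A \<in> carrier (mod_quot M N)"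
  then obtain x where x: "x \<in> carrier M" "A = N +>\<^bsub>M\<^esub> x"
    using cosets_cases by auto
  show "the_elem (h ` A) \<in> carrier P"
    using x by (simp add: * lin)
  show "the_elem (h ` (a \<odot>\<^bsub>mod_quot M N\<^esub> A)) = a \<odot>\<^bsub>P\<^esub> the_elem (h ` A)" if "a \<in> carrier F" for a
    using x that by (simp add: * lin coset_smult)
  fix B assume "B \<in> carrier (mod_quot M N)"
  then obtain y where y: "y \<in> carrier M" "B = N +>\<^bsub>M\<^esub> y"
    using cosets_cases by auto
  show "the_elem (h ` (A \<oplus>\<^bsub>mod_quot M N\<^esub> B)) = the_elem (h ` A) \<oplus>\<^bsub>P\<^esub> the_elem (h ` B)"
    using x y by (simp add: * lin coset_add)
qed

end

section \<open>Bilinear forms\<close>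

lemma Bil_sel:
  "zero (Bil F U V) = (\<lambda>p\<in>carrier U \<times> carrier V. \<zero>\<^bsub>F\<^esub>)"
  "add (Bil F U V) f g = (\<lambda>p\<in>carrier U \<times> carrier V. f p \<oplus>\<^bsub>F\<^esub> g p)"
  "smult (Bil F U V) a f = (\<lambda>p\<in>carrier U \<times> carrier V. a \<otimes>\<^bsub>F\<^esub> f p)"
  by (simp_all add: Bil_def)

lemma Bil_apply [simp]:
  assumes "u \<in> carrier U" "v \<in> carrier V"
  shows "\<zero>\<^bsub>Bil F U V\<^esub> (u, v) = \<zero>\<^bsub>F\<^esub>"
    and "(f \<oplus>\<^bsub>Bil F U V\<^esub> g) (u, v) = f (u, v) \<oplus>\<^bsub>F\<^esub> g (u, v)"
    and "(a \<odot>\<^bsub>Bil F U V\<^esub> f) (u, v) = a \<otimes>\<^bsub>F\<^esub> f (u, v)"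
  using assms by (simp_all add: Bil_sel)

lemma Bil_iff:
  "f \<in> carrier (Bil F U V) \<longleftrightarrow> f \<in> extensional (carrier U \<times> carrier V) \<and>
    (\<forall>u\<in>carrier U. (\<lambda>v. f (u, v)) \<in> lin_maps F V (field_module F)) \<and>
    (\<forall>v\<in>carrier V. (\<lambda>u. f (u, v)) \<in> lin_maps F U (field_module F))"
  by (simp add: Bil_def)

lemma Bil_linear_right:
    "\<lbrakk>f \<in> carrier (Bil F U V); u \<in> carrier U\<rbrakk> \<Longrightarrow> (\<lambda>v. f (u, v)) \<in> lin_maps F V (field_module F)"
  and Bil_linear_left:
    "\<lbrakk>f \<in> carrier (Bil F U V); v \<in> carrier V\<rbrakk> \<Longrightarrow> (\<lambda>u. f (u, v)) \<in> lin_maps F U (field_module F)"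
  by (simp_all add: Bil_iff)

lemma Bil_closed:
  "\<lbrakk>f \<in> carrier (Bil F U V); u \<in> carrier U; v \<in> carrier V\<rbrakk> \<Longrightarrow> f (u, v) \<in> carrier F"
  using lin_maps_closed[OF Bil_linear_right[of f F U V u]] by simp

lemma Bil_zero_right:
    "\<lbrakk>f \<in> carrier (Bil F U V); u \<in> carrier U; cring F; module F V\<rbrakk> \<Longrightarrow> f (u, \<zero>\<^bsub>V\<^esub>) = \<zero>\<^bsub>F\<^esub>"
  and Bil_zero_left:
    "\<lbrakk>f \<in> carrier (Bil F U V); v \<in> carrier V; cring F; module F U\<rbrakk> \<Longrightarrow> f (\<zero>\<^bsub>U\<^esub>, v) = \<zero>\<^bsub>F\<^esub>"
  using lin_maps_zero[OF Bil_linear_right[of f F U V u] _ module_field_module]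
    lin_maps_zero[OF Bil_linear_left[of f F U V v] _ module_field_module] by simp_all

lemma Bil_add_right:
    "\<lbrakk>f \<in> carrier (Bil F U V); u \<in> carrier U; v \<in> carrier V; v' \<in> carrier V\<rbrakk>
      \<Longrightarrow> f (u, v \<oplus>\<^bsub>V\<^esub> v') = f (u, v) \<oplus>\<^bsub>F\<^esub> f (u, v')"
  and Bil_add_left:
    "\<lbrakk>f \<in> carrier (Bil F U V); u \<in> carrier U; u' \<in> carrier U; v \<in> carrier V\<rbrakk>
      \<Longrightarrow> f (u \<oplus>\<^bsub>U\<^esub> u', v) = f (u, v) \<oplus>\<^bsub>F\<^esub> f (u', v)"
  using lin_maps_add[OF Bil_linear_right[of f F U V u]] lin_maps_add[OF Bil_linear_left[of f F U V v]]
  by simp_all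

lemma Bil_extensional: "f \<in> carrier (Bil F U V) \<Longrightarrow> f \<in> extensional (carrier U \<times> carrier V)"
  by (simp add: Bil_iff)

lemma restrict_in_Bil:
  assumes "module F U" "module F V"
    and "\<And>u. u \<in> carrier U \<Longrightarrow> (\<lambda>v. f (u, v)) \<in> lin_maps F V (field_module F)"
    and "\<And>v. v \<in> carrier V \<Longrightarrow> (\<lambda>u. f (u, v)) \<in> lin_maps F U (field_module F)"
  shows "restrict f (carrier U \<times> carrier V) \<in> carrier (Bil F U V)"
  unfolding Bil_iff
proof (intro conjI ballI)
  fix u assume u: "u \<in> carrier U"
  show "(\<lambda>v. restrict f (carrier U \<times> carrier V) (u, v)) \<in> lin_maps F V (field_module F)"
    using assms(3)[OF u] u by (subst lin_maps_cong[OF assms(2), where k = "\<lambda>v. f (u, v)"]) auto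
next
  fix v assume v: "v \<in> carrier V"
  show "(\<lambda>u. restrict f (carrier U \<times> carrier V) (u, v)) \<in> lin_maps F U (field_module F)"
    using assms(4)[OF v] v by (subst lin_maps_cong[OF assms(1), where k = "\<lambda>u. f (u, v)"]) auto
qed simp

lemma Bil_eqI:
  assumes "f \<in> carrier (Bil F U V)" "g \<in> carrier (Bil F U V)"
    and "\<And>u v. \<lbrakk>u \<in> carrier U; v \<in> carrier V\<rbrakk> \<Longrightarrow> f (u, v) = g (u, v)"
  shows "f = g"
  using assms by (intro extensionalityI[of f "carrier U \<times> carrier V" g]) (auto dest: Bil_extensional)

lemma module_Bil:
  assumes "cring F" "module F U" "module F V"
  shows "module F (Bil F U V)"
proof -
  interpret cring F by fact
  let ?B = "Bil F U V"
  note pw = lin_maps_pointwise[OF module_field_module[OF assms(1)], simplified]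
  note lin = Bil_linear_left[where F = F and U = U and V = V] Bil_linear_right[where F = F and U = U and V = V]
  note eqI = Bil_eqI[where F = F and U = U and V = V]
  have add: "f \<oplus>\<^bsub>?B\<^esub> g \<in> carrier ?B" if "f \<in> carrier ?B" "g \<in> carrier ?B" for f g
    unfolding Bil_sel by (intro restrict_in_Bil assms pw lin[of f] lin[of g] that)
  have smult: "a \<odot>\<^bsub>?B\<^esub> f \<in> carrier ?B" if "a \<in> carrier F" "f \<in> carrier ?B" for a f
    unfolding Bil_sel by (intro restrict_in_Bil assms pw lin[of f] that)
  have zero: "\<zero>\<^bsub>?B\<^esub> \<in> carrier ?B"
    unfolding Bil_sel by (intro restrict_in_Bil assms pw)
  have inv: "\<exists>g\<in>carrier ?B. g \<oplus>\<^bsub>?B\<^esub> f = \<zero>\<^bsub>?B\<^esub>" if f: "f \<in> carrier ?B" for f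
  proof (rule bexI)
    \<comment> \<open>Taking the negative as the multiple by -1 reduces its bilinearity to closure
      under scalars.\<close>
    show *: "(\<ominus>\<^bsub>F\<^esub> \<one>\<^bsub>F\<^esub>) \<odot>\<^bsub>?B\<^esub> f \<in> carrier ?B"
      using f by (intro smult) simp_all
    show "(\<ominus>\<^bsub>F\<^esub> \<one>\<^bsub>F\<^esub>) \<odot>\<^bsub>?B\<^esub> f \<oplus>\<^bsub>?B\<^esub> f = \<zero>\<^bsub>?B\<^esub>"
      by (rule eqI) (use f * in \<open>auto simp: Bil_closed l_minus l_neg intro: add zero\<close>)
  qed
  show ?thesis
  proof (rule moduleI[OF assms(1) abelian_groupI])
    fix f g h assume fgh: "f \<in> carrier ?B" "g \<in> carrier ?B" "h \<in> carrier ?B"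
    show "f \<oplus>\<^bsub>?B\<^esub> g \<oplus>\<^bsub>?B\<^esub> h = f \<oplus>\<^bsub>?B\<^esub> (g \<oplus>\<^bsub>?B\<^esub> h)"
      by (rule eqI) (use fgh in \<open>auto simp: Bil_closed a_assoc intro: add\<close>)
  next
    fix f g assume fg: "f \<in> carrier ?B" "g \<in> carrier ?B"
    show "f \<oplus>\<^bsub>?B\<^esub> g = g \<oplus>\<^bsub>?B\<^esub> f"
      by (rule eqI) (use fg in \<open>auto simp: Bil_closed a_comm intro: add\<close>)
    fix a assume a: "a \<in> carrier F"
    show "a \<odot>\<^bsub>?B\<^esub> (f \<oplus>\<^bsub>?B\<^esub> g) = a \<odot>\<^bsub>?B\<^esub> f \<oplus>\<^bsub>?B\<^esub> a \<odot>\<^bsub>?B\<^esub> g"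
      by (rule eqI) (use fg a in \<open>auto simp: Bil_closed r_distr intro: add smult\<close>)
  next
    fix f a b assume f: "f \<in> carrier ?B" and ab: "a \<in> carrier F" "b \<in> carrier F"
    show "(a \<oplus>\<^bsub>F\<^esub> b) \<odot>\<^bsub>?B\<^esub> f = a \<odot>\<^bsub>?B\<^esub> f \<oplus>\<^bsub>?B\<^esub> b \<odot>\<^bsub>?B\<^esub> f"
      by (rule eqI) (use f ab in \<open>auto simp: Bil_closed l_distr intro: add smult\<close>)
    show "(a \<otimes>\<^bsub>F\<^esub> b) \<odot>\<^bsub>?B\<^esub> f = a \<odot>\<^bsub>?B\<^esub> (b \<odot>\<^bsub>?B\<^esub> f)"
      by (rule eqI) (use f ab in \<open>auto simp: Bil_closed m_assoc intro: smult\<close>)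
  next
    fix f assume f: "f \<in> carrier ?B"
    show "\<zero>\<^bsub>?B\<^esub> \<oplus>\<^bsub>?B\<^esub> f = f"
      by (rule eqI) (use f in \<open>auto simp: Bil_closed intro: add zero\<close>)
    show "\<one>\<^bsub>F\<^esub> \<odot>\<^bsub>?B\<^esub> f = f"
      by (rule eqI) (use f in \<open>auto simp: Bil_closed intro: smult\<close>)
  qed (fact add smult zero inv)+
qed

section \<open>Quotients and derived algebra\<close>

lemma tri_quot_sel [simp]:
  "carrier (tri_quot L I) = carrier (mod_quot L I)"
  "add (tri_quot L I) = add (mod_quot L I)"
  "zero (tri_quot L I) = zero (mod_quot L I)"
  "smult (tri_quot L I) = smult (mod_quot L I)"
  by (simp_all add: tri_quot_def module.defs tri_alg.defs ring.defs)

lemma prd_tri_quot: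
  "prd (tri_quot L I) op A C = (\<Union>x\<in>A. \<Union>y\<in>C. I +>\<^bsub>L\<^esub> prd L op x y)"
  by (simp add: tri_quot_def module.defs tri_alg.defs)

lemma lin_maps_tri_quot [simp]:
  "lin_maps F (tri_quot L I) P = lin_maps F (mod_quot L I) P"
  "lin_maps F P (tri_quot L I) = lin_maps F P (mod_quot L I)"
  by (simp_all add: lin_maps_def hom_def)

context triassociative_algebra
begin

lemma prd_closed [simp]: "\<lbrakk>x \<in> carrier L; y \<in> carrier L\<rbrakk> \<Longrightarrow> prd L op x y \<in> carrier L"
  using lin_maps_closed[OF prd_linear_right] by fastforce

lemma prd_add:
  assumes "x \<in> carrier L" "y \<in> carrier L" "z \<in> carrier L"
  shows prd_add_left: "prd L op (x \<oplus>\<^bsub>L\<^esub> y) z = prd L op x z \<oplus>\<^bsub>L\<^esub> prd L op y z"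
    and prd_add_right: "prd L op z (x \<oplus>\<^bsub>L\<^esub> y) = prd L op z x \<oplus>\<^bsub>L\<^esub> prd L op z y"
  using lin_maps_add[OF prd_linear_left[of z op]] lin_maps_add[OF prd_linear_right[of z op]] assms
  by auto

lemma prd_smult:
  assumes "a \<in> carrier F" "x \<in> carrier L" "y \<in> carrier L"
  shows prd_smult_left: "prd L op (a \<odot>\<^bsub>L\<^esub> x) y = a \<odot>\<^bsub>L\<^esub> prd L op x y"
    and prd_smult_right: "prd L op x (a \<odot>\<^bsub>L\<^esub> y) = a \<odot>\<^bsub>L\<^esub> prd L op x y"
  using lin_maps_smult[OF prd_linear_left[of y op]] lin_maps_smult[OF prd_linear_right[of x op]] assms
  by auto

lemma submodule_prd_span: "submodule (prd_span F L op) F L"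
  unfolding prd_span_def by (rule submodule_mod_span) auto

lemma submodule_derived: "submodule (derived F L) F L"
  unfolding derived_def by (intro submodule_set_add submodule_prd_span)

sublocale derived: module_quotient F L "derived F L"
  by (intro module_quotient.intro module_axioms submodule_derived)

text \<open>The kernel of \<open>h\<close> is a submodule containing all products, hence each of the
  three spans and their sum.\<close>

lemma linear_vanishes_on_derived:
  assumes h: "h \<in> lin_maps F L P" and P: "module F P"
    and prd: "\<And>op x y. \<lbrakk>x \<in> carrier L; y \<in> carrier L\<rbrakk> \<Longrightarrow> h (prd L op x y) = \<zero>\<^bsub>P\<^esub>"
    and d: "d \<in> derived F L"
  shows "h d = \<zero>\<^bsub>P\<^esub>"
proof -
  let ?K = "{x \<in> carrier L. h x = \<zero>\<^bsub>P\<^esub>}"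
  have K: "submodule ?K F L"
    by (rule submodule_kernel[OF h module_axioms P])
  have "prd_span F L op \<subseteq> ?K" for op
    unfolding prd_span_def by (rule mod_span_least[OF K]) (auto simp: prd)
  then have "derived F L \<subseteq> ?K"
    unfolding derived_def by (intro set_add_subset K)
  with d show ?thesis by blast
qed

end

section \<open>The quotient of a triassociative algebra by an ideal\<close>

locale tri_quotient = triassociative_algebra F L + module_quotient F L I
  for F :: "('k, 'f) ring_scheme" and L :: "('k, 'a, 'm) tri_alg_scheme" and I +
  assumes ideal_left: "\<lbrakk>i \<in> I; x \<in> carrier L\<rbrakk> \<Longrightarrow> prd L op i x \<in> I"
    and ideal_right: "\<lbrakk>i \<in> I; x \<in> carrier L\<rbrakk> \<Longrightarrow> prd L op x i \<in> I"
begin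

lemma prd_coset:
  assumes x: "x \<in> carrier L" and y: "y \<in> carrier L"
  shows "prd (tri_quot L I) op (I +>\<^bsub>L\<^esub> x) (I +>\<^bsub>L\<^esub> y) = I +>\<^bsub>L\<^esub> prd L op x y"
proof -
  have "I +>\<^bsub>L\<^esub> prd L op x' y' = I +>\<^bsub>L\<^esub> prd L op x y"
    if "x' \<in> I +>\<^bsub>L\<^esub> x" "y' \<in> I +>\<^bsub>L\<^esub> y" for x' y'
  proof -
    from that obtain i j where ij: "i \<in> I" "j \<in> I" and eq: "x' = i \<oplus>\<^bsub>L\<^esub> x" "y' = j \<oplus>\<^bsub>L\<^esub> y"
      by (auto simp: in_coset_iff)
    have L: "i \<in> carrier L" "j \<in> carrier L"
      using ij by simp_all
    \<comment> \<open>The first two summands lie in I and stand in front, so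
      \<open>coset_add_left\<close> strips them one after the other.\<close>
    have "prd L op x' y' = prd L op i (j \<oplus>\<^bsub>L\<^esub> y) \<oplus>\<^bsub>L\<^esub> (prd L op x j \<oplus>\<^bsub>L\<^esub> prd L op x y)"
      using x y L by (simp add: eq prd_add M.a_ac)
    then show ?thesis
      using x y ij L by (simp add: coset_add_left ideal_left ideal_right)
  qed
  moreover have "x \<in> I +>\<^bsub>L\<^esub> x" "y \<in> I +>\<^bsub>L\<^esub> y"
    using x y by (simp_all add: a_rcos_self)
  ultimately show ?thesis
    unfolding prd_tri_quot by blast
qed

lemma triassociative_tri_quot: "triassociative_algebra F (tri_quot L I)"
proof (intro triassociative_algebra.intro triassociative_algebra_axioms.intro tri_identities.intro)
  show "field F" by (rule field_axioms)
  show "module F (tri_quot L I)"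
    using module_mod_quot by (rule module_cong) simp_all
next
  fix A B C
  assume "A \<in> carrier (tri_quot L I)" "B \<in> carrier (tri_quot L I)" "C \<in> carrier (tri_quot L I)"
  then obtain x y z where "x \<in> carrier L" "A = I +>\<^bsub>L\<^esub> x" "y \<in> carrier L" "B = I +>\<^bsub>L\<^esub> y"
    "z \<in> carrier L" "C = I +>\<^bsub>L\<^esub> z"
    using cosets_cases by (metis tri_quot_sel(1) mod_quot_sel(1))
  note xyz = this
  let ?Q = "tri_quot L I"
  show "(A \<turnstile>\<^bsub>?Q\<^esub> B) \<turnstile>\<^bsub>?Q\<^esub> C = A \<turnstile>\<^bsub>?Q\<^esub> (B \<turnstile>\<^bsub>?Q\<^esub> C)"
    "(A \<stileturn>\<^bsub>?Q\<^esub> B) \<stileturn>\<^bsub>?Q\<^esub> C = A \<stileturn>\<^bsub>?Q\<^esub> (B \<stileturn>\<^bsub>?Q\<^esub> C)"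
    "(A \<stileturn>\<^bsub>?Q\<^esub> B) \<turnstile>\<^bsub>?Q\<^esub> C = A \<turnstile>\<^bsub>?Q\<^esub> (B \<turnstile>\<^bsub>?Q\<^esub> C)"
    "(A \<turnstile>\<^bsub>?Q\<^esub> B) \<stileturn>\<^bsub>?Q\<^esub> C = A \<turnstile>\<^bsub>?Q\<^esub> (B \<stileturn>\<^bsub>?Q\<^esub> C)"
    "(A \<bottom>\<^bsub>?Q\<^esub> B) \<turnstile>\<^bsub>?Q\<^esub> C = A \<turnstile>\<^bsub>?Q\<^esub> (B \<turnstile>\<^bsub>?Q\<^esub> C)"
    "(A \<turnstile>\<^bsub>?Q\<^esub> B) \<bottom>\<^bsub>?Q\<^esub> C = A \<turnstile>\<^bsub>?Q\<^esub> (B \<bottom>\<^bsub>?Q\<^esub> C)"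
    "(A \<bottom>\<^bsub>?Q\<^esub> B) \<stileturn>\<^bsub>?Q\<^esub> C = A \<bottom>\<^bsub>?Q\<^esub> (B \<stileturn>\<^bsub>?Q\<^esub> C)"
    "(A \<stileturn>\<^bsub>?Q\<^esub> B) \<bottom>\<^bsub>?Q\<^esub> C = A \<bottom>\<^bsub>?Q\<^esub> (B \<turnstile>\<^bsub>?Q\<^esub> C)"
    "(A \<bottom>\<^bsub>?Q\<^esub> B) \<bottom>\<^bsub>?Q\<^esub> C = A \<bottom>\<^bsub>?Q\<^esub> (B \<bottom>\<^bsub>?Q\<^esub> C)"
    by (simp_all add: prd_coset xyz tri_identities(1,2,3,5,6,8,9,10,11))
  \<comment> \<open>Identities 2, 4 and 7 have the same left-hand side and would compete as rewrite
    rules; 4 and 7 are therefore applied separately.\<close>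
  show "(A \<stileturn>\<^bsub>?Q\<^esub> B) \<stileturn>\<^bsub>?Q\<^esub> C = A \<stileturn>\<^bsub>?Q\<^esub> (B \<turnstile>\<^bsub>?Q\<^esub> C)"
    by (simp add: prd_coset xyz tri_identities(4))
  show "(A \<stileturn>\<^bsub>?Q\<^esub> B) \<stileturn>\<^bsub>?Q\<^esub> C = A \<stileturn>\<^bsub>?Q\<^esub> (B \<bottom>\<^bsub>?Q\<^esub> C)"
    by (simp add: prd_coset xyz tri_identities(7))
next
  fix A op assume "A \<in> carrier (tri_quot L I)"
  then obtain x where x: "x \<in> carrier L" "A = I +>\<^bsub>L\<^esub> x"
    using cosets_cases by auto
  show "prd (tri_quot L I) op A \<in> lin_maps F (tri_quot L I) (tri_quot L I)"
    by (rule lin_mapsI)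
       (auto elim!: cosets_cases simp: x prd_coset coset_add coset_smult prd_add prd_smult)
  show "(\<lambda>B. prd (tri_quot L I) op B A) \<in> lin_maps F (tri_quot L I) (tri_quot L I)"
    by (rule lin_mapsI)
       (auto elim!: cosets_cases simp: x prd_coset coset_add coset_smult prd_add prd_smult)
qed

end

context tri_quotient
begin

text \<open>Everything proved below about cocycles of a triassociative algebra becomes available for
  L/I under the prefix \<open>Q\<close>.\<close>

sublocale Q: triassociative_algebra F "tri_quot L I"
  by (rule triassociative_tri_quot)

end

section \<open>Cocycles and coboundaries\<close>

text \<open>Isolates the dependence on \<open>\<epsilon>\<close>: \<open>B2\<close> becomes the
  image of the linear forms, and its closure properties follow from linearity in
  \<open>\<epsilon>\<close>.\<close>

definition coboundary ::
  "('k, 'f) ring_scheme \<Rightarrow> ('k, 'a, 'm) tri_alg_scheme \<Rightarrow> ('a \<Rightarrow> 'k) \<Rightarrow> tri_op \<Rightarrow> 'a \<times> 'a \<Rightarrow> 'k"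
  where "coboundary F B \<epsilon> =
    (\<lambda>op. \<lambda>(x, y)\<in>carrier B \<times> carrier B. \<ominus>\<^bsub>F\<^esub> \<epsilon> (prd B op x y))"

lemma B2_eq: "B2 F B = coboundary F B ` lin_maps F B (field_module F)"
  unfolding B2_def coboundary_def by auto

lemma coboundary_apply [simp]:
  "\<lbrakk>x \<in> carrier B; y \<in> carrier B\<rbrakk> \<Longrightarrow> coboundary F B \<epsilon> op (x, y) = \<ominus>\<^bsub>F\<^esub> \<epsilon> (prd B op x y)"
  by (simp add: coboundary_def)

lemma Z2_carrier:
  "f \<in> carrier (Z2 F B) \<longleftrightarrow> (\<forall>op. f op \<in> carrier (Bil F B B)) \<and> cocycle_identities B f"
  by (simp add: Z2_def)

lemma Z2_sel [simp]:
  "add (Z2 F B) f g = (\<lambda>op. f op \<oplus>\<^bsub>Bil F B B\<^esub> g op)"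
  "zero (Z2 F B) = (\<lambda>op. \<zero>\<^bsub>Bil F B B\<^esub>)"
  "smult (Z2 F B) a f = (\<lambda>op. a \<odot>\<^bsub>Bil F B B\<^esub> f op)"
  by (simp_all add: Z2_def)

lemma Z2_eqI:
  assumes "\<And>op. f op \<in> carrier (Bil F B B)" "\<And>op. g op \<in> carrier (Bil F B B)"
    and "\<And>op x y. \<lbrakk>x \<in> carrier B; y \<in> carrier B\<rbrakk> \<Longrightarrow> f op (x, y) = g op (x, y)"
  shows "f = g"
  by (rule ext, rule Bil_eqI[OF assms(1) assms(2)]) (rule assms(3))

text \<open>
  Three of the identities share the left-hand side \<open>f Dashv (x \<stileturn> y, z)\<close>; these equations join their
  right-hand sides, so that all identities together can be used as rewrite rules.
\<close>

lemma (in cocycle_identities) dashv_right: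
  assumes "x \<in> carrier B" "y \<in> carrier B" "z \<in> carrier B"
  shows "f Dashv (x, y \<turnstile> z) = f Dashv (x, y \<stileturn> z)" "f Dashv (x, y \<bottom> z) = f Dashv (x, y \<stileturn> z)"
  using assms cocycle_identities(2,4,7) by metis+

context triassociative_algebra
begin

lemma uminus_add: "\<lbrakk>a \<in> carrier F; b \<in> carrier F\<rbrakk> \<Longrightarrow> \<ominus>\<^bsub>F\<^esub> (a \<oplus>\<^bsub>F\<^esub> b) = \<ominus>\<^bsub>F\<^esub> a \<oplus>\<^bsub>F\<^esub> \<ominus>\<^bsub>F\<^esub> b"
  by (rule abelian_group.minus_add[OF ring.is_abelian_group[OF ring_axioms]])

lemma module_field: "module F (field_module F)"
  by (rule module_field_module) (rule cring_axioms)

lemma module_forms: "module F (Bil F L L)"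
  by (intro module_Bil cring_axioms module_axioms)

text \<open>Each cocycle identity equates two values that depend linearly on \<open>f\<close>, so it
  survives sums and multiples.\<close>

lemma submodule_cocycles:
  "submodule {f \<in> carrier (mod_cube (Bil F L L)). cocycle_identities L f} F (mod_cube (Bil F L L))"
proof -
  interpret B: module F "Bil F L L" by (rule module_forms)
  interpret C: module F "mod_cube (Bil F L L)" by (rule module_mod_cube) (rule module_forms)
  show ?thesis
  \<comment> \<open>The goals are, in order: inclusion in the carrier (left to the final
    \<open>auto\<close>), zero, sums, scalar multiples.\<close>
  proof (rule C.submoduleI_smult, goal_cases)
    case 2
    show ?case by (auto intro!: cocycle_identities.intro)
  next
    case (3 f g)
    then have f: "cocycle_identities L f" and g: "cocycle_identities L g" by auto
    note ids = cocycle_identities.cocycle_identities[OF f] cocycle_identities.cocycle_identities[OF g]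
      cocycle_identities.dashv_right[OF f] cocycle_identities.dashv_right[OF g]
    show ?case
      using 3 by (auto intro!: cocycle_identities.intro simp: ids)
  next
    case (4 a f)
    then have f: "cocycle_identities L f" by auto
    note ids = cocycle_identities.cocycle_identities[OF f] cocycle_identities.dashv_right[OF f]
    show ?case
      using 4 by (auto intro!: cocycle_identities.intro simp: ids)
  qed auto
qed

lemma module_Z2: "module F (Z2 F L)"
  unfolding Z2_def
  by (rule submodule.submodule_is_module[OF submodule_cocycles])
     (intro module_mod_cube module_forms)

lemma coboundary_in_Z2:
  assumes \<epsilon>: "\<epsilon> \<in> lin_maps F L (field_module F)"
  shows "coboundary F L \<epsilon> \<in> carrier (Z2 F L)"
  unfolding Z2_carrier
proof
  have neg: "(\<lambda>x. \<ominus>\<^bsub>F\<^esub> h x) \<in> lin_maps F L (field_module F)"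
    if h: "h \<in> lin_maps F L (field_module F)" for h
    using lin_mapsD[OF h] by (intro lin_mapsI) (auto simp: uminus_add r_minus)
  have "restrict (\<lambda>(x, y). \<ominus>\<^bsub>F\<^esub> \<epsilon> (prd L op x y)) (carrier L \<times> carrier L) \<in> carrier (Bil F L L)" for op
    by (rule restrict_in_Bil)
       (auto intro!: module_axioms neg lin_maps_comp[OF _ \<epsilon>] prd_linear_left prd_linear_right)
  then show "\<forall>op. coboundary F L \<epsilon> op \<in> carrier (Bil F L L)"
    unfolding coboundary_def by blast
  show "cocycle_identities L (coboundary F L \<epsilon>)"
    \<comment> \<open>Each cocycle identity is the image of the corresponding algebra identity under
      \<open>-\<epsilon>\<close>.\<close>
    by unfold_locales (use tri_identities in \<open>auto intro!: arg_cong[of _ _ "\<lambda>x. \<ominus>\<^bsub>F\<^esub> \<epsilon> x"]\<close>)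
qed

lemma submodule_B2: "submodule (B2 F L) F (Z2 F L)"
proof -
  interpret Z2: module F "Z2 F L" by (rule module_Z2)
  note pw = lin_maps_pointwise[OF module_field, simplified]
  note in_Bil = coboundary_in_Z2[unfolded Z2_carrier, THEN conjunct1, rule_format]
  show ?thesis
  proof (rule Z2.submoduleI_smult)
    show "B2 F L \<subseteq> carrier (Z2 F L)"
      by (auto simp: B2_eq coboundary_in_Z2)
    have "coboundary F L (\<lambda>x. \<zero>\<^bsub>F\<^esub>) = \<zero>\<^bsub>Z2 F L\<^esub>"
      using Z2.zero_closed unfolding Z2_carrier
      by (intro Z2_eqI[where F = F and B = L]) (auto intro!: in_Bil pw)
    then show "\<zero>\<^bsub>Z2 F L\<^esub> \<in> B2 F L"
      unfolding B2_eq by (metis imageI pw(1))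
  next
    fix f g assume "f \<in> B2 F L" "g \<in> B2 F L"
    then obtain \<epsilon> \<eta> where lin: "\<epsilon> \<in> lin_maps F L (field_module F)" "\<eta> \<in> lin_maps F L (field_module F)"
      and fg: "f = coboundary F L \<epsilon>" "g = coboundary F L \<eta>"
      by (auto simp: B2_eq)
    have "f \<oplus>\<^bsub>Z2 F L\<^esub> g = coboundary F L (\<lambda>x. \<epsilon> x \<oplus>\<^bsub>F\<^esub> \<eta> x)"
    proof (rule Z2_eqI[where F = F and B = L])
      show "(f \<oplus>\<^bsub>Z2 F L\<^esub> g) op \<in> carrier (Bil F L L)" for op
        using Z2.add.m_closed coboundary_in_Z2 lin fg unfolding Z2_carrier by blast
    qed (use lin in \<open>auto simp: fg uminus_add lin_maps_closed[where N = "field_module F", simplified]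
          intro!: in_Bil pw\<close>)
    then show "f \<oplus>\<^bsub>Z2 F L\<^esub> g \<in> B2 F L"
      unfolding B2_eq using pw(2)[OF lin] by blast
  next
    fix a f assume a: "a \<in> carrier F" and "f \<in> B2 F L"
    then obtain \<epsilon> where lin: "\<epsilon> \<in> lin_maps F L (field_module F)" and f: "f = coboundary F L \<epsilon>"
      by (auto simp: B2_eq)
    have "a \<odot>\<^bsub>Z2 F L\<^esub> f = coboundary F L (\<lambda>x. a \<otimes>\<^bsub>F\<^esub> \<epsilon> x)"
    proof (rule Z2_eqI[where F = F and B = L])
      show "(a \<odot>\<^bsub>Z2 F L\<^esub> f) op \<in> carrier (Bil F L L)" for op
        using Z2.smult_closed[OF a] coboundary_in_Z2 lin f unfolding Z2_carrier by blast
    qed (use lin a in \<open>auto simp: f r_minus lin_maps_closed[where N = "field_module F", simplified]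
          intro!: in_Bil pw\<close>)
    then show "a \<odot>\<^bsub>Z2 F L\<^esub> f \<in> B2 F L"
      unfolding B2_eq using pw(3)[OF a lin] by blast
  qed
qed

lemma module_quotient_H2: "module_quotient F (Z2 F L) (B2 F L)"
  by (intro module_quotient.intro module_Z2 submodule_B2)

lemma cocycle_bilinear: "f \<in> carrier (Z2 F L) \<Longrightarrow> f op \<in> carrier (Bil F L L)"
  by (simp add: Z2_carrier)

lemmas cocycle_linear_right = Bil_linear_right[OF cocycle_bilinear]
lemmas cocycle_linear_left = Bil_linear_left[OF cocycle_bilinear]
lemmas cocycle_closed = Bil_closed[OF cocycle_bilinear]
lemmas cocycle_add = Bil_add_left[OF cocycle_bilinear] Bil_add_right[OF cocycle_bilinear]
lemmas cocycle_zero = Bil_zero_left[OF cocycle_bilinear _ cring_axioms module_axioms]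
  Bil_zero_right[OF cocycle_bilinear _ cring_axioms module_axioms]

lemma cocycle_vanishes_on_derived:
  assumes f: "f \<in> carrier (Z2 F L)" and z: "z \<in> tri_center L" and d: "d \<in> derived F L"
  shows "f op (d, z) = \<zero>\<^bsub>F\<^esub>" "f op (z, d) = \<zero>\<^bsub>F\<^esub>"
proof -
  have zL: "z \<in> carrier L"
    and prd_z: "\<And>op x. x \<in> carrier L \<Longrightarrow> prd L op z x = \<zero>\<^bsub>L\<^esub>"
      "\<And>op x. x \<in> carrier L \<Longrightarrow> prd L op x z = \<zero>\<^bsub>L\<^esub>"
    using z by (auto simp: tri_center_def)
  have cocycle: "cocycle_identities L f"
    using f by (simp add: Z2_carrier)
  note ids = cocycle_identities.cocycle_identities[OF cocycle]
  note s = zL prd_z cocycle_zero[OF f]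
  \<comment> \<open>The nine selected identities have on their left-hand sides every pair
    \<open>(op, op')\<close> exactly once (4 and 7 repeat 2). On the right, \<open>z\<close> is
    multiplied by \<open>y\<close> and the product is zero.\<close>
  have left: "f op (prd L op' x y, z) = \<zero>\<^bsub>F\<^esub>" if "x \<in> carrier L" "y \<in> carrier L" for op op' x y
    using that by (cases op; cases op'; simp add: ids(1-3,5,6,8-11) s)
  \<comment> \<open>Now the identities are read from right to left with \<open>z\<close> in first
    place. The right-hand sides again cover every pair exactly once (3 and 6 repeat 1), and the
    left-hand sides contain a product of \<open>z\<close> with \<open>x\<close>, which is
    zero.\<close>
  have right: "f op (z, prd L op' x y) = \<zero>\<^bsub>F\<^esub>" if "x \<in> carrier L" "y \<in> carrier L" for op op' x y
    using that by (cases op; cases op'; simp add: ids(1,2,4,5,7-11)[OF zL that, symmetric] s)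
  show "f op (d, z) = \<zero>\<^bsub>F\<^esub>"
    using linear_vanishes_on_derived[OF cocycle_linear_left[OF f zL] module_field _ d] left by simp
  show "f op (z, d) = \<zero>\<^bsub>F\<^esub>"
    using linear_vanishes_on_derived[OF cocycle_linear_right[OF f zL] module_field _ d] right by simp
qed

end

section \<open>Inflation and the map \<open>\<delta>\<close>\<close>

lemma inf_cochain_apply [simp]:
  "\<lbrakk>x \<in> carrier L; y \<in> carrier L\<rbrakk>
    \<Longrightarrow> inf_cochain L Z f op (x, y) = f op (Z +>\<^bsub>L\<^esub> x, Z +>\<^bsub>L\<^esub> y)"
  by (simp add: inf_cochain_def)

context tri_quotient
begin

text \<open>Inflation is pullback along the projection to L/I, which is linear and multiplicative,
  so bilinearity and the identities both pull back.\<close>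

lemma inf_cochain_in_Z2:
  assumes f: "f \<in> carrier (Z2 F (tri_quot L I))"
  shows "inf_cochain L I f \<in> carrier (Z2 F L)"
  unfolding Z2_carrier
proof
  let ?Q = "tri_quot L I"
  have "restrict (\<lambda>(x, y). f op (I +>\<^bsub>L\<^esub> x, I +>\<^bsub>L\<^esub> y)) (carrier L \<times> carrier L) \<in> carrier (Bil F L L)" for op
  proof (rule restrict_in_Bil[OF module_axioms module_axioms], simp_all only: prod.case)
    fix x assume "x \<in> carrier L"
    then have x: "I +>\<^bsub>L\<^esub> x \<in> carrier ?Q" by simp
    show "(\<lambda>y. f op (I +>\<^bsub>L\<^esub> x, I +>\<^bsub>L\<^esub> y)) \<in> lin_maps F L (field_module F)"
      using Q.cocycle_linear_right[OF f x] by (intro lin_maps_comp[OF coset_linear]) simp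
    show "(\<lambda>y. f op (I +>\<^bsub>L\<^esub> y, I +>\<^bsub>L\<^esub> x)) \<in> lin_maps F L (field_module F)"
      using Q.cocycle_linear_left[OF f x]
      by (intro lin_maps_comp[OF coset_linear, of "\<lambda>A. f op (A, I +>\<^bsub>L\<^esub> x)"]) simp
  qed
  then show "\<forall>op. inf_cochain L I f op \<in> carrier (Bil F L L)"
    unfolding inf_cochain_def by blast
  have cocycle: "cocycle_identities ?Q f"
    using f by (simp add: Z2_carrier)
  note ids = cocycle_identities.cocycle_identities[OF cocycle] cocycle_identities.dashv_right[OF cocycle]
  show "cocycle_identities L (inf_cochain L I f)"
    \<comment> \<open>Read backwards, \<open>prd_coset\<close> turns the coset of a product into a
      product of cosets, to which the identities of \<open>f\<close> apply.\<close>
    by (rule cocycle_identities.intro) (simp_all add: prd_coset[symmetric] ids)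
qed

lemma inf_cochain_linear: "inf_cochain L I \<in> lin_maps F (Z2 F (tri_quot L I)) (Z2 F L)"
proof -
  interpret Z: module F "Z2 F L" by (rule module_Z2)
  interpret ZQ: module F "Z2 F (tri_quot L I)" by (rule Q.module_Z2)
  show ?thesis
  proof (rule lin_mapsI)
    fix f assume f: "f \<in> carrier (Z2 F (tri_quot L I))"
    show "inf_cochain L I f \<in> carrier (Z2 F L)"
      by (rule inf_cochain_in_Z2[OF f])
    show "inf_cochain L I (a \<odot>\<^bsub>Z2 F (tri_quot L I)\<^esub> f) = a \<odot>\<^bsub>Z2 F L\<^esub> inf_cochain L I f"
      if a: "a \<in> carrier F" for a
    proof (rule Z2_eqI)
      show "inf_cochain L I (a \<odot>\<^bsub>Z2 F (tri_quot L I)\<^esub> f) op \<in> carrier (Bil F L L)" for op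
        by (intro cocycle_bilinear inf_cochain_in_Z2 ZQ.smult_closed a f)
      show "(a \<odot>\<^bsub>Z2 F L\<^esub> inf_cochain L I f) op \<in> carrier (Bil F L L)" for op
        by (intro cocycle_bilinear inf_cochain_in_Z2 Z.smult_closed a f)
    qed simp
    fix g assume g: "g \<in> carrier (Z2 F (tri_quot L I))"
    show "inf_cochain L I (f \<oplus>\<^bsub>Z2 F (tri_quot L I)\<^esub> g) = inf_cochain L I f \<oplus>\<^bsub>Z2 F L\<^esub> inf_cochain L I g"
    proof (rule Z2_eqI)
      show "inf_cochain L I (f \<oplus>\<^bsub>Z2 F (tri_quot L I)\<^esub> g) op \<in> carrier (Bil F L L)" for op
        by (intro cocycle_bilinear inf_cochain_in_Z2 ZQ.add.m_closed f g)
      show "(inf_cochain L I f \<oplus>\<^bsub>Z2 F L\<^esub> inf_cochain L I g) op \<in> carrier (Bil F L L)" for op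
        by (intro cocycle_bilinear inf_cochain_in_Z2 Z.add.m_closed f g)
    qed simp
  qed
qed

text \<open>The form whose coboundary is the inflated one is \<open>\<epsilon>\<close> composed with
  the projection. This makes \<open>Inf_map\<close> independent of the representative.\<close>

lemma inf_cochain_in_B2:
  assumes "f \<in> B2 F (tri_quot L I)"
  shows "inf_cochain L I f \<in> B2 F L"
proof -
  obtain \<epsilon> where \<epsilon>: "\<epsilon> \<in> lin_maps F (mod_quot L I) (field_module F)"
    and f: "f = coboundary F (tri_quot L I) \<epsilon>"
    using assms by (auto simp: B2_eq)
  have lin: "(\<lambda>x. \<epsilon> (I +>\<^bsub>L\<^esub> x)) \<in> lin_maps F L (field_module F)"
    by (rule lin_maps_comp[OF coset_linear \<epsilon>])
  have "inf_cochain L I f = coboundary F L (\<lambda>x. \<epsilon> (I +>\<^bsub>L\<^esub> x))"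
    using \<epsilon>
    by (intro Z2_eqI[where F = F and B = L] cocycle_bilinear inf_cochain_in_Z2 coboundary_in_Z2 lin)
       (simp_all add: f Q.coboundary_in_Z2 prd_coset)
  then show ?thesis
    unfolding B2_eq using lin by blast
qed

sublocale H2: module_quotient F "Z2 F L" "B2 F L"
  by (rule module_quotient_H2)

sublocale H2Q: module_quotient F "Z2 F (tri_quot L I)" "B2 F (tri_quot L I)"
  by (rule Q.module_quotient_H2)

lemma inf_class_const:
  assumes "b \<in> B2 F (tri_quot L I)" "f \<in> carrier (Z2 F (tri_quot L I))"
  shows "B2 F L +>\<^bsub>Z2 F L\<^esub> inf_cochain L I (b \<oplus>\<^bsub>Z2 F (tri_quot L I)\<^esub> f)
    = B2 F L +>\<^bsub>Z2 F L\<^esub> inf_cochain L I f"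
  using assms inf_cochain_in_B2 inf_cochain_in_Z2
  by (simp only: lin_maps_add[OF inf_cochain_linear] H2Q.a_Hcarr H2.coset_add_left)

lemma Inf_map_class:
  "f \<in> carrier (Z2 F (tri_quot L I)) \<Longrightarrow>
    Inf_map F L I (B2 F (tri_quot L I) +>\<^bsub>Z2 F (tri_quot L I)\<^esub> f)
      = B2 F L +>\<^bsub>Z2 F L\<^esub> inf_cochain L I f"
  unfolding Inf_map_def by (rule H2Q.the_elem_coset) (simp_all only: inf_class_const)

lemma Inf_map_linear: "Inf_map F L I \<in> lin_maps F (H2 F (tri_quot L I)) (H2 F L)"
proof -
  have "(\<lambda>f. B2 F L +>\<^bsub>Z2 F L\<^esub> inf_cochain L I f) \<in> lin_maps F (Z2 F (tri_quot L I)) (mod_quot (Z2 F L) (B2 F L))"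
    by (rule lin_maps_comp[OF inf_cochain_linear H2.coset_linear])
  from H2Q.linear_on_quotient[OF this inf_class_const] show ?thesis
    unfolding H2_def Inf_map_def[abs_def] .
qed

end

section \<open>Central ideals and the pairings of L/L' with Z\<close>

locale central_quotient = triassociative_algebra F L + module_quotient F L Z
  for F :: "('k, 'f) ring_scheme" and L :: "('k, 'a, 'm) tri_alg_scheme" and Z +
  assumes central: "Z \<subseteq> tri_center L"
begin

text \<open>All products with an element of Z are zero, and zero lies in Z; this gives the ideal
  laws.\<close>

sublocale tri_quotient F L Z
proof
  fix z x op assume zx: "z \<in> Z" "x \<in> carrier L"
  then have "prd L op z x = \<zero>\<^bsub>L\<^esub>" "prd L op x z = \<zero>\<^bsub>L\<^esub>"
    using central by (auto simp: tri_center_def)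
  then show "prd L op z x \<in> Z" "prd L op x z \<in> Z"
    by simp_all
qed

text \<open>Bilinearity splits off the term in \<open>d\<close>, which vanishes by the result on L'.
  This is the constancy on cosets of L' that \<open>the_elem\<close> asks for.\<close>

lemma delta_const:
  assumes f: "f \<in> carrier (Z2 F L)" and z: "z \<in> Z" and d: "d \<in> derived F L" and x: "x \<in> carrier L"
  shows "f op (d \<oplus>\<^bsub>L\<^esub> x, z) = f op (x, z)" "f op (z, d \<oplus>\<^bsub>L\<^esub> x) = f op (z, x)"
  using assms subsetD[OF central z] derived.a_Hcarr[OF d]
  by (simp_all add: cocycle_add cocycle_vanishes_on_derived cocycle_closed)

lemma delta_cochain_apply:
  assumes f: "f \<in> carrier (Z2 F L)" and z: "z \<in> Z" and x: "x \<in> carrier L"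
  shows "fst (delta_cochain F L Z f op) (derived F L +>\<^bsub>L\<^esub> x, z) = f op (x, z)"
    and "snd (delta_cochain F L Z f op) (z, derived F L +>\<^bsub>L\<^esub> x) = f op (z, x)"
  using z x derived.the_elem_coset[of x "\<lambda>y. f op (y, z)"] derived.the_elem_coset[of x "\<lambda>y. f op (z, y)"]
  by (simp_all add: delta_cochain_def delta_const[OF f z])

lemma module_Z: "module F (L\<lparr>carrier := Z\<rparr>)"
  by (rule S.submodule_is_module[OF module_axioms])

lemma module_abelianization: "module F (tri_quot L (derived F L))"
  by (rule module_cong[OF derived.module_mod_quot]) simp_all

lemmas module_pairings =
  module_Bil[OF cring_axioms module_abelianization module_Z]
  module_Bil[OF cring_axioms module_Z module_abelianization]

lemma module_delta_target: "module F (delta_target F L Z)"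
  unfolding delta_target_def by (intro module_mod_cube module_mod_sum module_pairings)

lemma delta_cochain_in_target:
  assumes f: "f \<in> carrier (Z2 F L)"
  shows "delta_cochain F L Z f \<in> carrier (delta_target F L Z)"
proof -
  let ?D = "tri_quot L (derived F L)" and ?Z = "L\<lparr>carrier := Z\<rparr>"
  have coset: "the_elem ((\<lambda>x. f op (x, z)) ` (derived F L +>\<^bsub>L\<^esub> x)) = f op (x, z)"
    "the_elem ((\<lambda>x. f op (z, x)) ` (derived F L +>\<^bsub>L\<^esub> x)) = f op (z, x)"
    if "z \<in> Z" "x \<in> carrier L" for op x z
    using that derived.the_elem_coset[of x "\<lambda>y. f op (y, z)"] derived.the_elem_coset[of x "\<lambda>y. f op (z, y)"]
    by (simp_all add: delta_const[OF f])
  have linD: "(\<lambda>A. the_elem ((\<lambda>x. f op (x, z)) ` A)) \<in> lin_maps F ?D (field_module F)"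
    "(\<lambda>A. the_elem ((\<lambda>x. f op (z, x)) ` A)) \<in> lin_maps F ?D (field_module F)"
    if z: "z \<in> Z" for op z
    using derived.linear_on_quotient[OF cocycle_linear_left[OF f, of z op]]
      derived.linear_on_quotient[OF cocycle_linear_right[OF f, of z op]] z
    by (simp_all add: delta_const[OF f z])
  \<comment> \<open>In the variable \<open>z\<close> nothing descends to a quotient: a fixed
    representative \<open>x\<close> of \<open>A\<close> turns the term into a slice of
    \<open>f\<close>, restricted to Z.\<close>
  have linZ: "(\<lambda>z. the_elem ((\<lambda>x. f op (x, z)) ` A)) \<in> lin_maps F ?Z (field_module F)"
    "(\<lambda>z. the_elem ((\<lambda>x. f op (z, x)) ` A)) \<in> lin_maps F ?Z (field_module F)"
    if A_in: "A \<in> carrier ?D" for op A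
  proof -
    obtain x where x: "x \<in> carrier L" and A: "A = derived F L +>\<^bsub>L\<^esub> x"
      using A_in derived.cosets_cases by auto
    have "(\<lambda>z. f op (x, z)) \<in> lin_maps F ?Z (field_module F)"
      by (intro lin_maps_subspace cocycle_linear_right[OF f x] a_subset)
    then show "(\<lambda>z. the_elem ((\<lambda>x. f op (x, z)) ` A)) \<in> lin_maps F ?Z (field_module F)"
      using x by (subst lin_maps_cong[OF module_Z, where k = "\<lambda>z. f op (x, z)"]) (simp_all add: A coset)
    have "(\<lambda>z. f op (z, x)) \<in> lin_maps F ?Z (field_module F)"
      by (intro lin_maps_subspace cocycle_linear_left[OF f x] a_subset)
    then show "(\<lambda>z. the_elem ((\<lambda>x. f op (z, x)) ` A)) \<in> lin_maps F ?Z (field_module F)"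
      using x by (subst lin_maps_cong[OF module_Z, where k = "\<lambda>z. f op (z, x)"]) (simp_all add: A coset)
  qed
  have "restrict (\<lambda>(A, z). the_elem ((\<lambda>x. f op (x, z)) ` A)) (carrier ?D \<times> carrier ?Z) \<in> carrier (Bil F ?D ?Z)"
    for op
    by (rule restrict_in_Bil[OF module_abelianization module_Z]) (use linD linZ in auto)
  moreover have "restrict (\<lambda>(z, A). the_elem ((\<lambda>x. f op (z, x)) ` A)) (carrier ?Z \<times> carrier ?D) \<in> carrier (Bil F ?Z ?D)"
    for op
    by (rule restrict_in_Bil[OF module_Z module_abelianization]) (use linD linZ in auto)
  ultimately show ?thesis
    by (simp add: delta_target_def delta_cochain_def)
qed

text \<open>An element of the target is determined by its values at cosets of \<open>x\<close>
  paired with \<open>z\<close>, and there \<open>delta_cochain\<close> returns the value of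
  \<open>f\<close> itself. Linearity, invariance under coboundaries and the vanishing criterion thus
  become equations about values of \<open>f\<close>.\<close>

lemma delta_cochain_eqI:
  assumes f: "f \<in> carrier (Z2 F L)" and t: "t \<in> carrier (delta_target F L Z)"
    and eq: "\<And>op x z. \<lbrakk>x \<in> carrier L; z \<in> Z\<rbrakk> \<Longrightarrow> fst (t op) (derived F L +>\<^bsub>L\<^esub> x, z) = f op (x, z)"
      "\<And>op x z. \<lbrakk>x \<in> carrier L; z \<in> Z\<rbrakk> \<Longrightarrow> snd (t op) (z, derived F L +>\<^bsub>L\<^esub> x) = f op (z, x)"
  shows "delta_cochain F L Z f = t"
proof (rule ext, rule prod_eqI)
  let ?D = "tri_quot L (derived F L)" and ?Z = "L\<lparr>carrier := Z\<rparr>"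
  fix op
  have "delta_cochain F L Z f op \<in> carrier (Bil F ?D ?Z) \<times> carrier (Bil F ?Z ?D)"
    "t op \<in> carrier (Bil F ?D ?Z) \<times> carrier (Bil F ?Z ?D)"
    using delta_cochain_in_target[OF f] t by (simp_all add: delta_target_def)
  note mem = this[THEN mem_Times_iff[THEN iffD1]]
  show "fst (delta_cochain F L Z f op) = fst (t op)"
  proof (rule Bil_eqI)
    fix A z assume "A \<in> carrier ?D" "z \<in> carrier ?Z"
    moreover from this obtain x where "x \<in> carrier L" "A = derived F L +>\<^bsub>L\<^esub> x"
      using derived.cosets_cases by auto
    ultimately show "fst (delta_cochain F L Z f op) (A, z) = fst (t op) (A, z)"
      by (simp add: delta_cochain_apply[OF f] eq)
  qed (use mem in blast)+
  show "snd (delta_cochain F L Z f op) = snd (t op)"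
  proof (rule Bil_eqI)
    fix A z assume "z \<in> carrier ?Z" "A \<in> carrier ?D"
    moreover from this obtain x where "x \<in> carrier L" "A = derived F L +>\<^bsub>L\<^esub> x"
      using derived.cosets_cases by auto
    ultimately show "snd (delta_cochain F L Z f op) (z, A) = snd (t op) (z, A)"
      by (simp add: delta_cochain_apply[OF f] eq)
  qed (use mem in blast)+
qed

lemma delta_target_apply:
  assumes "x \<in> carrier L" "z \<in> Z"
  shows "fst ((s \<oplus>\<^bsub>delta_target F L Z\<^esub> t) op) (derived F L +>\<^bsub>L\<^esub> x, z)
      = fst (s op) (derived F L +>\<^bsub>L\<^esub> x, z) \<oplus>\<^bsub>F\<^esub> fst (t op) (derived F L +>\<^bsub>L\<^esub> x, z)"
    and "snd ((s \<oplus>\<^bsub>delta_target F L Z\<^esub> t) op) (z, derived F L +>\<^bsub>L\<^esub> x)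
      = snd (s op) (z, derived F L +>\<^bsub>L\<^esub> x) \<oplus>\<^bsub>F\<^esub> snd (t op) (z, derived F L +>\<^bsub>L\<^esub> x)"
    and "fst ((a \<odot>\<^bsub>delta_target F L Z\<^esub> t) op) (derived F L +>\<^bsub>L\<^esub> x, z)
      = a \<otimes>\<^bsub>F\<^esub> fst (t op) (derived F L +>\<^bsub>L\<^esub> x, z)"
    and "snd ((a \<odot>\<^bsub>delta_target F L Z\<^esub> t) op) (z, derived F L +>\<^bsub>L\<^esub> x)
      = a \<otimes>\<^bsub>F\<^esub> snd (t op) (z, derived F L +>\<^bsub>L\<^esub> x)"
    and "fst (\<zero>\<^bsub>delta_target F L Z\<^esub> op) (derived F L +>\<^bsub>L\<^esub> x, z) = \<zero>\<^bsub>F\<^esub>"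
    and "snd (\<zero>\<^bsub>delta_target F L Z\<^esub> op) (z, derived F L +>\<^bsub>L\<^esub> x) = \<zero>\<^bsub>F\<^esub>"
  using assms by (simp_all add: delta_target_def)

lemma delta_cochain_linear: "delta_cochain F L Z \<in> lin_maps F (Z2 F L) (delta_target F L Z)"
proof (rule lin_mapsI)
  interpret T: module F "delta_target F L Z" by (rule module_delta_target)
  fix f assume f: "f \<in> carrier (Z2 F L)"
  show "delta_cochain F L Z f \<in> carrier (delta_target F L Z)"
    by (rule delta_cochain_in_target[OF f])
  show "delta_cochain F L Z (a \<odot>\<^bsub>Z2 F L\<^esub> f) = a \<odot>\<^bsub>delta_target F L Z\<^esub> delta_cochain F L Z f"
    if a: "a \<in> carrier F" for a
    by (intro delta_cochain_eqI T.smult_closed H2.smult_closed delta_cochain_in_target a f)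
       (simp_all add: delta_target_apply delta_cochain_apply[OF f])
  fix g assume g: "g \<in> carrier (Z2 F L)"
  show "delta_cochain F L Z (f \<oplus>\<^bsub>Z2 F L\<^esub> g) = delta_cochain F L Z f \<oplus>\<^bsub>delta_target F L Z\<^esub> delta_cochain F L Z g"
    by (intro delta_cochain_eqI T.add.m_closed H2.M.add.m_closed delta_cochain_in_target f g)
       (simp_all add: delta_target_apply delta_cochain_apply[OF f] delta_cochain_apply[OF g])
qed

lemma delta_cochain_coboundary:
  assumes b: "b \<in> B2 F L" and f: "f \<in> carrier (Z2 F L)"
  shows "delta_cochain F L Z (b \<oplus>\<^bsub>Z2 F L\<^esub> f) = delta_cochain F L Z f"
proof (rule delta_cochain_eqI)
  show "b \<oplus>\<^bsub>Z2 F L\<^esub> f \<in> carrier (Z2 F L)"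
    by (intro H2.M.add.m_closed H2.a_Hcarr b f)
  show "delta_cochain F L Z f \<in> carrier (delta_target F L Z)"
    by (rule delta_cochain_in_target[OF f])
  obtain \<epsilon> where \<epsilon>: "\<epsilon> \<in> lin_maps F L (field_module F)" and b_eq: "b = coboundary F L \<epsilon>"
    using b by (auto simp: B2_eq)
  \<comment> \<open>For \<open>z\<close> in Z the products of \<open>x\<close> and \<open>z\<close>
    are zero, so the coboundary takes the value \<open>-\<epsilon>(0)\<close> there.\<close>
  have "\<epsilon> \<zero>\<^bsub>L\<^esub> = \<zero>\<^bsub>F\<^esub>"
    using lin_maps_zero[OF \<epsilon> module_axioms module_field] by simp
  then have "b op (x, z) = \<zero>\<^bsub>F\<^esub>" "b op (z, x) = \<zero>\<^bsub>F\<^esub>" if "x \<in> carrier L" "z \<in> Z" for op x z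
    using that subsetD[OF central that(2)] by (simp_all add: b_eq tri_center_def)
  then show "fst (delta_cochain F L Z f op) (derived F L +>\<^bsub>L\<^esub> x, z) = (b \<oplus>\<^bsub>Z2 F L\<^esub> f) op (x, z)"
    "snd (delta_cochain F L Z f op) (z, derived F L +>\<^bsub>L\<^esub> x) = (b \<oplus>\<^bsub>Z2 F L\<^esub> f) op (z, x)"
    if "x \<in> carrier L" "z \<in> Z" for op x z
    using that by (simp_all add: delta_cochain_apply[OF f] cocycle_closed[OF f])
qed

lemma delta_map_class:
  "f \<in> carrier (Z2 F L) \<Longrightarrow> delta_map F L Z (B2 F L +>\<^bsub>Z2 F L\<^esub> f) = delta_cochain F L Z f"
  unfolding delta_map_def by (rule H2.the_elem_coset) (simp_all only: delta_cochain_coboundary)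

lemma delta_map_linear: "delta_map F L Z \<in> lin_maps F (H2 F L) (delta_target F L Z)"
  using H2.linear_on_quotient[OF delta_cochain_linear delta_cochain_coboundary]
  unfolding H2_def delta_map_def[abs_def] .

lemma delta_vanishes_iff:
  assumes f: "f \<in> carrier (Z2 F L)"
  shows "delta_cochain F L Z f = \<zero>\<^bsub>delta_target F L Z\<^esub> \<longleftrightarrow>
    (\<forall>op. \<forall>x\<in>carrier L. \<forall>z\<in>Z. f op (x, z) = \<zero>\<^bsub>F\<^esub> \<and> f op (z, x) = \<zero>\<^bsub>F\<^esub>)"
proof -
  interpret T: module F "delta_target F L Z" by (rule module_delta_target)
  show ?thesis
  proof (intro iffI allI ballI)
    fix op x z
    assume eq: "delta_cochain F L Z f = \<zero>\<^bsub>delta_target F L Z\<^esub>" and xz: "x \<in> carrier L" "z \<in> Z"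
    show "f op (x, z) = \<zero>\<^bsub>F\<^esub> \<and> f op (z, x) = \<zero>\<^bsub>F\<^esub>"
      using delta_cochain_apply[OF f xz(2,1), of op] by (simp add: eq delta_target_apply xz)
  next
    assume "\<forall>op. \<forall>x\<in>carrier L. \<forall>z\<in>Z. f op (x, z) = \<zero>\<^bsub>F\<^esub> \<and> f op (z, x) = \<zero>\<^bsub>F\<^esub>"
    then show "delta_cochain F L Z f = \<zero>\<^bsub>delta_target F L Z\<^esub>"
      by (intro delta_cochain_eqI f T.zero_closed) (simp_all add: delta_target_apply)
  qed
qed

section \<open>Exactness at the cohomology of L\<close>

text \<open>The coset of an element of Z is Z, the zero of L/Z, where a bilinear form vanishes. The
  composite is thus zero already on cochains.\<close>

lemma delta_cochain_inf_cochain: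
  assumes f: "f \<in> carrier (Z2 F (tri_quot L Z))"
  shows "delta_cochain F L Z (inf_cochain L Z f) = \<zero>\<^bsub>delta_target F L Z\<^esub>"
  using Q.cocycle_zero[OF f] by (simp add: delta_vanishes_iff[OF inf_cochain_in_Z2[OF f]] coset_of_mem)

lemma cocycle_descends:
  assumes f: "f \<in> carrier (Z2 F L)"
    and "delta_cochain F L Z f = \<zero>\<^bsub>delta_target F L Z\<^esub>"
  obtains g where "g \<in> carrier (Z2 F (tri_quot L Z))" "inf_cochain L Z g = f"
proof
  let ?Q = "tri_quot L Z"
  \<comment> \<open>The descent is made one slot at a time: the inner \<open>the_elem\<close>
    removes the choice of \<open>y\<close> in \<open>C\<close>, the outer one that of
    \<open>x\<close> in \<open>A\<close>.\<close>
  define g where "g = (\<lambda>op. \<lambda>(A, C)\<in>carrier ?Q \<times> carrier ?Q.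
    the_elem ((\<lambda>x. the_elem ((\<lambda>y. f op (x, y)) ` C)) ` A))"
  have vanish: "f op (x, z) = \<zero>\<^bsub>F\<^esub>" "f op (z, x) = \<zero>\<^bsub>F\<^esub>" if "x \<in> carrier L" "z \<in> Z" for op x z
    using assms that by (simp_all add: delta_vanishes_iff)
  \<comment> \<open>Vanishing on Z becomes invariance under translation by Z in either slot.\<close>
  have const: "f op (z \<oplus>\<^bsub>L\<^esub> x, y) = f op (x, y)" "f op (y, z \<oplus>\<^bsub>L\<^esub> x) = f op (y, x)"
    if "z \<in> Z" "x \<in> carrier L" "y \<in> carrier L" for op x y z
    using that by (simp_all add: cocycle_add[OF f] cocycle_closed[OF f] vanish)
  have inner: "the_elem ((\<lambda>y. f op (x, y)) ` (Z +>\<^bsub>L\<^esub> y)) = f op (x, y)"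
    if "x \<in> carrier L" "y \<in> carrier L" for op x y
    using that by (intro the_elem_coset const)
  have g_coset: "g op (Z +>\<^bsub>L\<^esub> x, Z +>\<^bsub>L\<^esub> y) = f op (x, y)"
    if "x \<in> carrier L" "y \<in> carrier L" for op x y
    using that the_elem_coset[of x "\<lambda>x. the_elem ((\<lambda>y. f op (x, y)) ` (Z +>\<^bsub>L\<^esub> y))"]
    by (simp add: g_def inner const)
  have lin: "(\<lambda>C. g op (A, C)) \<in> lin_maps F ?Q (field_module F)"
    "(\<lambda>C. g op (C, A)) \<in> lin_maps F ?Q (field_module F)"
    if A_in: "A \<in> carrier ?Q" for op A
  proof -
    obtain x where x: "x \<in> carrier L" and A: "A = Z +>\<^bsub>L\<^esub> x"
      using A_in cosets_cases by auto
    \<comment> \<open>With one slot fixed at a representative, the nested term agrees with a single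
      \<open>the_elem\<close>, the shape that \<open>linear_on_quotient\<close> handles.\<close>
    have g_eq: "g op (A, C) = the_elem ((\<lambda>y. f op (x, y)) ` C)"
      "g op (C, A) = the_elem ((\<lambda>y. f op (y, x)) ` C)" if C_in: "C \<in> carrier ?Q" for C
    proof -
      obtain y where y: "y \<in> carrier L" and C: "C = Z +>\<^bsub>L\<^esub> y"
        using C_in cosets_cases by auto
      show "g op (A, C) = the_elem ((\<lambda>y. f op (x, y)) ` C)"
        using x y by (simp add: A C g_coset inner)
      show "g op (C, A) = the_elem ((\<lambda>y. f op (y, x)) ` C)"
        using x y the_elem_coset[of y "\<lambda>y. f op (y, x)"] by (simp add: A C g_coset const)
    qed
    show "(\<lambda>C. g op (A, C)) \<in> lin_maps F ?Q (field_module F)"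
      using linear_on_quotient[OF cocycle_linear_right[OF f x, of op]] x
      by (subst lin_maps_cong[OF Q.module_axioms, where k = "\<lambda>C. the_elem ((\<lambda>y. f op (x, y)) ` C)"])
         (simp_all add: g_eq const)
    show "(\<lambda>C. g op (C, A)) \<in> lin_maps F ?Q (field_module F)"
      using linear_on_quotient[OF cocycle_linear_left[OF f x, of op]] x
      by (subst lin_maps_cong[OF Q.module_axioms, where k = "\<lambda>C. the_elem ((\<lambda>y. f op (y, x)) ` C)"])
         (simp_all add: g_eq const)
  qed
  have bil: "g op \<in> carrier (Bil F ?Q ?Q)" for op
  proof -
    \<comment> \<open>\<open>g op\<close> is restricted by definition, so restricting it again
      changes nothing.\<close>
    have "restrict (g op) (carrier ?Q \<times> carrier ?Q) \<in> carrier (Bil F ?Q ?Q)"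
      by (intro restrict_in_Bil Q.module_axioms lin)
    then show ?thesis
      by (simp add: g_def)
  qed
  have cocycle: "cocycle_identities L f"
    using f by (simp add: Z2_carrier)
  note ids = cocycle_identities.cocycle_identities[OF cocycle] cocycle_identities.dashv_right[OF cocycle]
  have "cocycle_identities ?Q g"
    by (rule cocycle_identities.intro)
       (auto elim!: cosets_cases simp: prd_coset g_coset ids)
  with bil show g: "g \<in> carrier (Z2 F ?Q)"
    by (simp add: Z2_carrier)
  show "inf_cochain L Z g = f"
    by (rule Z2_eqI[where F = F and B = L])
       (simp_all add: cocycle_bilinear inf_cochain_in_Z2 f g g_coset)
qed

lemma exact_Inf_delta:
  "exact_at F (H2 F (tri_quot L Z)) (Inf_map F L Z) (H2 F L) (delta_map F L Z) (delta_target F L Z)"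
  unfolding exact_at_def
proof (intro conjI Inf_map_linear delta_map_linear)
  show "Inf_map F L Z ` carrier (H2 F (tri_quot L Z)) = a_kernel (H2 F L) (delta_target F L Z) (delta_map F L Z)"
  proof (intro subset_antisym subsetI)
    fix c assume "c \<in> Inf_map F L Z ` carrier (H2 F (tri_quot L Z))"
    then obtain g where g: "g \<in> carrier (Z2 F (tri_quot L Z))"
      and c: "c = B2 F L +>\<^bsub>Z2 F L\<^esub> inf_cochain L Z g"
      by (auto simp: H2_def Inf_map_class elim!: H2Q.cosets_cases)
    show "c \<in> a_kernel (H2 F L) (delta_target F L Z) (delta_map F L Z)"
      using inf_cochain_in_Z2[OF g]
      by (simp add: c a_kernel_def' H2_def delta_map_class delta_cochain_inf_cochain[OF g])
  next
    fix c assume "c \<in> a_kernel (H2 F L) (delta_target F L Z) (delta_map F L Z)"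
    then obtain f where f: "f \<in> carrier (Z2 F L)" and c: "c = B2 F L +>\<^bsub>Z2 F L\<^esub> f"
      and "delta_cochain F L Z f = \<zero>\<^bsub>delta_target F L Z\<^esub>"
      by (auto simp: a_kernel_def' H2_def delta_map_class elim!: H2.cosets_cases)
    then obtain g where g: "g \<in> carrier (Z2 F (tri_quot L Z))" and "inf_cochain L Z g = f"
      using cocycle_descends by blast
    \<comment> \<open>The class of \<open>g\<close> is a preimage because \<open>g\<close> inflates
      to the chosen representative \<open>f\<close> on the nose.\<close>
    then have "c = Inf_map F L Z (B2 F (tri_quot L Z) +>\<^bsub>Z2 F (tri_quot L Z)\<^esub> g)"
      by (simp add: c Inf_map_class)
    then show "c \<in> Inf_map F L Z ` carrier (H2 F (tri_quot L Z))"
      using g by (simp add: H2_def)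
  qed
qed

end

theorem theorem5p1:
  fixes F :: "('k, 'f) ring_scheme" and L :: "('k, 'a, 'm) tri_alg_scheme" and Z :: "'a set"
  assumes "triassociative_algebra F L"
    and "central_ideal F L Z"
  shows "exact_at F (H2 F (tri_quot L Z)) (Inf_map F L Z) (H2 F L) (delta_map F L Z) (delta_target F L Z)"
proof -
  interpret triassociative_algebra F L by fact
  have "central_quotient F L Z"
    using assms(2) unfolding central_ideal_def tri_ideal_def
    by (intro central_quotient.intro module_quotient.intro central_quotient_axioms.intro
        assms(1) module_axioms) simp_all
  then show ?thesis
    by (rule central_quotient.exact_Inf_delta)
qed

end
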